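(* There exists an algorithm that, given two normal swords of height at most $h$, returns their longest common prefix.
   Context: Fix a non-empty alphabet $A$ and a symbol $\omega$. $\mathbb{Z}$-unary words over $A$ and their heights are defined inductively: the empty word is a $\mathbb{Z}$-unary word of height $-\infty$; each letter of $A$ is one of height $0$; if $\sigma$ is a non-empty $\mathbb{Z}$-unary word of height $h$ and $q\in\mathbb{Z}$, the formal expression $(\sigma)^{\omega+q}$ is one of height $h+1$; if $\sigma_1,\sigma_2$ are $\mathbb{Z}$-unary words of heights $h_1,h_2$, the concatenation $\sigma_1\sigma_2$ is one of height $\max\{h_1,h_2\}$. Let $Z(A)$ be the set of all $\mathbb{Z}$-unary words; under concatenation it is the free monoid on $A$ together with all formal expressions $(\sigma)^{\omega+q}$. The length $|\sigma|\in\mathbb{Z}[\omega]$ is defined by: $0$ for the empty word, $1$ for letters, $|\sigma^{\omega+q}|=(\omega+q)|\sigma|$, $|\sigma\tau|=|\sigma|+|\tau|$. For $f,g\in\mathbb{Z}[\omega]$, $f\ge g$ means that the leading coefficient of $f-g$ is non-negative. Let $\mathcal{S}$ be the smallest equivalence relation on $Z(A)$ that is compatible with concatenation and with all unary operations $\sigma\mapsto\sigma^{\omega+q}$ and contains all pairs $(x^{\omega+q},xx^{\omega+q-1})$, $(x^{\omega+q},x^{\omega+q-1}x)$, $(x(yx)^{\omega+q},(xy)^{\omega+q}x)$ with $x,y$ non-empty $\mathbb{Z}$-unary words and $q\in\mathbb{Z}$. An $\mathcal{S}$-class is called a sword; the quotient of $Z(A)$ by $\mathcal{S}$ is denoted $\mathrm{Sing}(A)$.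 $\mathcal{S}$-related words have the same height and length, so heights and lengths of swords are well defined. A sword $\tau$ is a prefix of a sword $\sigma$ if $\sigma=\tau\rho$ for some (possibly empty) sword $\rho$. The longest common prefix of two swords is the common prefix of greatest length. Algorithms receive and return swords via representing $\mathbb{Z}$-unary words. Let $\mathcal{R}$ be the rewriting system on $Z(A)$ with the rules $x^{\omega+q}x^{\omega+r}\to x^{\omega+q+r}$, $(x^n)^{\omega+q}\to x^{\omega+nq}$, $(x^{\omega+r})^{\omega+q}\to x^{\omega+rq}$ for all non-empty $x\in Z(A)$, all $q,r\in\mathbb{Z}$ and all integers $n\ge2$; $\sigma\to\tau$ means that $\tau$ arises from $\sigma$ by one application of a rule to a subexpression (possibly inside $\omega$-powers). For swords $\alpha,\beta$ write $\alpha\to_{\mathcal{R}/\mathcal{S}}\beta$ if $\sigma\to\tau$ for some $\mathbb{Z}$-unary words $\sigma$ representing $\alpha$ and $\tau$ representing $\beta$. A sword $\alpha$ is normal if there is no sword $\beta$ with $\alpha\to_{\mathcal{R}/\mathcal{S}}\beta$. *)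

theory Defs
  imports
    Main
    "HOL-Library.Extended"
    "HOL-Library.Nat_Bijection"
    "HOL-Computational_Algebra.Polynomial"
begin

section \<open>\<int>-unary words\<close>

text \<open>
  The alphabet is the (automatically non-empty) type \<open>'a\<close>.  A \<int>-unary word is a list of free
  generators, and a generator is a letter or a formal power.  The base of a formal power must be
  non-empty, so it is stored as head and tail: \<open>Power a as q\<close> is the expression
  \<open>(a # as)\<close> to the power \<open>\<omega> + q\<close>.  Hence \<open>'a zword\<close> is exactly \<open>Z(A)\<close>.
\<close>

datatype 'a factor = Letter 'a | Power "'a factor" "'a factor list" int

type_synonym 'a zword = "'a factor list"

text \<open>The value at the empty word is a dummy; below \<open>zpow\<close> is only used on non-empty words.\<close>

fun zpow :: "'a zword \<Rightarrow> int \<Rightarrow> 'a zword" where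
  "zpow [] q = []"
| "zpow (a # as) q = [Power a as q]"

primrec factor_height :: "'a factor \<Rightarrow> nat extended" where
  "factor_height (Letter a) = Fin 0"
| "factor_height (Power a as q) = foldr max (map factor_height as) (factor_height a) + Fin 1"

definition word_height :: "'a zword \<Rightarrow> nat extended" where
  "word_height w = foldr max (map factor_height w) Minf"

text \<open>
  \<open>\<int>[\<omega>]\<close> is \<open>int poly\<close>, where \<open>\<omega> + q\<close> is \<open>[:q, 1:]\<close>.  The library order on \<open>int poly\<close> is the
  required one:
\<close>

lemma int_poly_ge_iff: "f \<ge> g \<longleftrightarrow> lead_coeff (f - g) \<ge> 0" for f g :: "int poly"
  unfolding less_eq_poly_def pos_poly_def
  by (metis eq_iff_diff_eq_0 le_less leading_coeff_0_iff)

primrec factor_length :: "'a factor \<Rightarrow> int poly" where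
  "factor_length (Letter a) = 1"
| "factor_length (Power a as q) =
     [:q, 1:] * (factor_length a + sum_list (map factor_length as))"

definition word_length :: "'a zword \<Rightarrow> int poly" where
  "word_length w = sum_list (map factor_length w)"

lemma word_height_simps:
  "word_height [] = Minf"
  "word_height [Letter c] = Fin 0"
  "x \<noteq> [] \<Longrightarrow> word_height (zpow x q) = word_height x + Fin 1"
  "word_height (x @ y) = max (word_height x) (word_height y)"
proof -
  have foldr_max: "foldr max hs k = max (foldr max hs Minf) k" for hs and k :: "nat extended"
    by (induction hs) (auto simp: max.assoc)
  show "word_height [] = Minf" "word_height [Letter c] = Fin 0"
    by (simp_all add: word_height_def)
  show "word_height (zpow x q) = word_height x + Fin 1" if "x \<noteq> []"
    using that foldr_max[of "map factor_height (tl x)" "factor_height (hd x)"]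
    by (cases x) (simp_all add: word_height_def max.commute)
  show "word_height (x @ y) = max (word_height x) (word_height y)"
    using foldr_max[of "map factor_height x" "word_height y"] by (simp add: word_height_def)
qed

lemma word_length_simps:
  "word_length [] = 0"
  "word_length [Letter c] = 1"
  "word_length (zpow x q) = [:q, 1:] * word_length x"
  "word_length (x @ y) = word_length x + word_length y"
  by (cases x; simp add: word_length_def)+


section \<open>Swords\<close>

inductive sword_eq :: "'a zword \<Rightarrow> 'a zword \<Rightarrow> bool" where
  refl: "sword_eq x x"
| sym: "sword_eq x y \<Longrightarrow> sword_eq y x"
| trans: "sword_eq x y \<Longrightarrow> sword_eq y z \<Longrightarrow> sword_eq x z"
| conc: "sword_eq x x' \<Longrightarrow> sword_eq y y' \<Longrightarrow> sword_eq (x @ y) (x' @ y')"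
| pow: "sword_eq x y \<Longrightarrow> x \<noteq> [] \<Longrightarrow> y \<noteq> [] \<Longrightarrow> sword_eq (zpow x q) (zpow y q)"
| unfold_left: "x \<noteq> [] \<Longrightarrow> sword_eq (zpow x q) (x @ zpow x (q - 1))"
| unfold_right: "x \<noteq> [] \<Longrightarrow> sword_eq (zpow x q) (zpow x (q - 1) @ x)"
| shift: "x \<noteq> [] \<Longrightarrow> y \<noteq> [] \<Longrightarrow> sword_eq (x @ zpow (y @ x) q) (zpow (x @ y) q @ x)"

lemma sword_eq_height: "sword_eq x y \<Longrightarrow> word_height x = word_height y"
proof (induction rule: sword_eq.induct)
  case (unfold_left x q)
  then show ?case by (cases "word_height x") (simp_all add: word_height_simps max_def)
next
  case (unfold_right x q)
  then show ?case by (cases "word_height x") (simp_all add: word_height_simps max_def)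
next
  case (shift x y q)
  then show ?case
    by (cases "word_height x"; cases "word_height y")
      (simp_all add: word_height_simps max_def)
qed (simp_all add: word_height_simps)

lemma sword_eq_length: "sword_eq x y \<Longrightarrow> word_length x = word_length y"
proof (induction rule: sword_eq.induct)
  case (unfold_left x q)
  have "[:q, 1:] = 1 + [:q - 1, 1:]" by (simp add: one_pCons)
  then show ?case by (simp add: word_length_simps algebra_simps)
next
  case (unfold_right x q)
  have "[:q, 1:] = 1 + [:q - 1, 1:]" by (simp add: one_pCons)
  then show ?case by (simp add: word_length_simps algebra_simps)
qed (simp_all add: word_length_simps algebra_simps)

lemma equivp_sword_eq: "equivp sword_eq"
  by (auto intro!: equivpI reflpI sympI transpI intro: sword_eq.refl sword_eq.sym sword_eq.trans)

quotient_type 'a sword = "'a zword" / sword_eq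
  morphisms rep_sword sword_of
  by (rule equivp_sword_eq)

lift_definition sword_height :: "'a sword \<Rightarrow> nat extended" is word_height
  by (rule sword_eq_height)

lift_definition sword_length :: "'a sword \<Rightarrow> int poly" is word_length
  by (rule sword_eq_length)

instantiation sword :: (type) monoid_mult
begin

lift_definition one_sword :: "'a sword" is "[]" .

lift_definition times_sword :: "'a sword \<Rightarrow> 'a sword \<Rightarrow> 'a sword" is "(@)"
  by (rule sword_eq.conc)

instance
  by standard (transfer, simp add: sword_eq.refl)+

end

definition sword_prefix :: "'a sword \<Rightarrow> 'a sword \<Rightarrow> bool" where
  "sword_prefix \<tau> \<sigma> \<longleftrightarrow> (\<exists>\<rho>. \<sigma> = \<tau> * \<rho>)"

definition common_prefix :: "'a sword \<Rightarrow> 'a sword \<Rightarrow> 'a sword \<Rightarrow> bool" where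
  "common_prefix \<alpha> \<beta> \<tau> \<longleftrightarrow> sword_prefix \<tau> \<alpha> \<and> sword_prefix \<tau> \<beta>"

text \<open>
  All other common prefixes are strictly shorter; so \<open>\<tau>\<close> has the greatest length and is the
  only common prefix of that length.
\<close>

definition longest_common_prefix :: "'a sword \<Rightarrow> 'a sword \<Rightarrow> 'a sword \<Rightarrow> bool" where
  "longest_common_prefix \<alpha> \<beta> \<tau> \<longleftrightarrow>
     common_prefix \<alpha> \<beta> \<tau> \<and>
     (\<forall>\<pi>. common_prefix \<alpha> \<beta> \<pi> \<and> \<pi> \<noteq> \<tau> \<longrightarrow> sword_length \<pi> < sword_length \<tau>)"


section \<open>Normal swords\<close>

inductive rule_R :: "'a zword \<Rightarrow> 'a zword \<Rightarrow> bool" where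
  "x \<noteq> [] \<Longrightarrow> rule_R (zpow x q @ zpow x r) (zpow x (q + r))"
| "x \<noteq> [] \<Longrightarrow> n \<ge> 2 \<Longrightarrow> rule_R (zpow (concat (replicate n x)) q) (zpow x (int n * q))"
| "x \<noteq> [] \<Longrightarrow> rule_R (zpow (zpow x r) q) (zpow x (r * q))"

inductive step_R :: "'a zword \<Rightarrow> 'a zword \<Rightarrow> bool" where
  rule: "rule_R x y \<Longrightarrow> step_R x y"
| conc: "step_R x y \<Longrightarrow> step_R (u @ x @ v) (u @ y @ v)"
| pow: "step_R x y \<Longrightarrow> x \<noteq> [] \<Longrightarrow> y \<noteq> [] \<Longrightarrow> step_R (zpow x q) (zpow y q)"

definition step_RS :: "'a sword \<Rightarrow> 'a sword \<Rightarrow> bool" where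
  "step_RS \<alpha> \<beta> \<longleftrightarrow> (\<exists>\<sigma> \<tau>. sword_of \<sigma> = \<alpha> \<and> sword_of \<tau> = \<beta> \<and> step_R \<sigma> \<tau>)"

definition normal_sword :: "'a sword \<Rightarrow> bool" where
  "normal_sword \<alpha> \<longleftrightarrow> (\<nexists>\<beta>. step_RS \<alpha> \<beta>)"


section \<open>Algorithms\<close>

text \<open>
  Algorithms are the usual programs for Kleene's partial recursive functions; the value
  \<open>None\<close> means that the computation does not terminate (or that an argument is missing).
  The recursion or search variable is the first argument, and \<open>PrimRec f g\<close> passes to \<open>g\<close>
  the counter, then the previous value, then the parameters.
\<close>

datatype recf = Zero | Succ | Proj nat | Comp recf "recf list" | PrimRec recf recf | Mu recf

primrec eval_recf :: "recf \<Rightarrow> nat list \<Rightarrow> nat option" where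
  "eval_recf Zero xs = Some 0"
| "eval_recf Succ xs = (case xs of [] \<Rightarrow> None | x # _ \<Rightarrow> Some (Suc x))"
| "eval_recf (Proj i) xs = (if i < length xs then Some (xs ! i) else None)"
| "eval_recf (Comp f gs) xs =
     Option.bind (those (map (\<lambda>e. e xs) (map eval_recf gs))) (eval_recf f)"
| "eval_recf (PrimRec f g) xs =
     (case xs of [] \<Rightarrow> None
      | n # ys \<Rightarrow>
          rec_nat (eval_recf f ys) (\<lambda>m r. Option.bind r (\<lambda>y. eval_recf g (m # y # ys))) n)"
| "eval_recf (Mu f) xs =
     (if \<exists>n. eval_recf f (n # xs) = Some 0 \<and> (\<forall>m<n. eval_recf f (m # xs) \<noteq> None)
      then Some (LEAST n. eval_recf f (n # xs) = Some 0)
      else None)"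

text \<open>Words as inputs and outputs, relative to a numbering \<open>code\<close> of the letters.\<close>

primrec encode_factor :: "('a \<Rightarrow> nat) \<Rightarrow> 'a factor \<Rightarrow> nat" where
  "encode_factor code (Letter a) = sum_encode (Inl (code a))"
| "encode_factor code (Power a as q) =
     sum_encode (Inr (prod_encode
       (list_encode (encode_factor code a # map (encode_factor code) as), int_encode q)))"

definition encode_word :: "('a \<Rightarrow> nat) \<Rightarrow> 'a zword \<Rightarrow> nat" where
  "encode_word code w = list_encode (map (encode_factor code) w)"

end

theory Submission
  imports Defs
begin

text \<open>
  The monoid of swords is equidivisible: if \<open>xy = zw\<close>, then \<open>x = zt\<close>, \<open>w = ty\<close> or \<open>z = xt\<close>,
  \<open>y = tw\<close> for some \<open>t\<close>. Hence it is left cancellative, and a common prefix is the longest one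
  as soon as the two remainders have no common first letter.

  That normal swords have such a common prefix is shown by induction on the height and the number of
  factors of maximal height. Compare \<open>u = w x\<^sup>\<omega>\<^sup>+\<^sup>q u'\<close> and \<open>v = y z\<^sup>\<omega>\<^sup>+\<^sup>r v'\<close>, where \<open>w\<close>, \<open>x\<close>,
  \<open>y\<close>, \<open>z\<close> have smaller height. If some \<open>w x\<^sup>k\<close> and \<open>y z\<^sup>l\<close> are not prefixes of each other, induction
  applies to them. Otherwise a Fine and Wilf argument makes a conjugate of \<open>x\<close> commute with \<open>z\<close>;
  commuting swords with normal product are powers (finite or \<open>\<omega> + q\<close>) of a common sword, so
  normality makes \<open>x\<close> and \<open>z\<close> conjugate, and a common power of \<open>x\<close> can be cancelled.

  Equality of swords is semidecidable, so the algorithm searches for a common prefix together with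
  remainders that have no common first letter and with derivations of the two factorizations.
\<close>

section \<open>Swords as a monoid with powers\<close>

text \<open>Swords are classes under rules without orientation, so equidivisibility cannot be read
  off words. Each word gets instead, by recursion on its syntax, a set \<open>splits\<close> of
  pairs of swords. Every rule of \<open>sword_eq\<close> preserves this set and a product
  \<open>p * s\<close> contributes the cut at its seam, so it is the set of all factorizations; that
  its members are pairwise nested is equidivisibility.

  Both induction measures come from the length polynomial and hence are defined on classes: the
  degree serves as height, and the top coefficient weighs the factors of maximal height, a power as
  much as its base.

  The result on commuting swords is proved by strong induction on the height, although Fine and Wilf
  at height \<open>e\<close> needs it at height \<open>e\<close> itself. There is no circle: a pair
  of different heights uses it only at the lower height, and a pair of equal heights is reduced by
  Euclidean subtraction.

  For the algorithm, a number need not encode a word: \<open>code\<close> need not be onto, and a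
  power may decode with an empty base. Derivations run over arbitrary numbers, so soundness must
  keep codes and other numbers apart.\<close>

lemma zpow_eq_Nil [simp]: "zpow x q = [] \<longleftrightarrow> x = []"
  by (cases x) simp_all

lemma sword_eq_Nil: "sword_eq x y \<Longrightarrow> x = [] \<longleftrightarrow> y = []"
  by (induction rule: sword_eq.induct) simp_all

text \<open>The dummy value of \<open>zpow\<close> at the empty word makes this total with
  \<open>opow 1 q = 1\<close>, so the laws below hold without non-emptiness conditions.\<close>

lift_definition opow :: "'a sword \<Rightarrow> int \<Rightarrow> 'a sword" is zpow
proof -
  fix x y :: "'a zword" and q assume "sword_eq x y"
  then show "sword_eq (zpow x q) (zpow y q)"
    using sword_eq_Nil[of x y] by (cases "x = []") (auto intro: sword_eq.intros)
qed

lift_definition letter :: "'a \<Rightarrow> 'a sword" is "\<lambda>a. [Letter a]" .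

lemma sword_of_simps:
  "sword_of [] = 1"
  "sword_of (x @ y) = sword_of x * sword_of y"
  "sword_of (zpow x q) = opow (sword_of x) q"
  "sword_of [Letter a] = letter a"
  by (transfer, simp add: sword_eq.refl)+

lemma sword_of_Cons: "sword_of (f # w) = sword_of [f] * sword_of w"
  using sword_of_simps(2)[of "[f]" w] by simp

lemma sword_of_Power: "sword_of [Power a as q] = opow (sword_of (a # as)) q"
  using sword_of_simps(3)[of "a # as" q] by simp

lemma sword_of_eq_iff: "sword_of x = sword_of y \<longleftrightarrow> sword_eq x y"
  by (simp add: sword.abs_eq_iff)

lemma sword_of_surj: obtains w where "x = sword_of w"
  using Quotient_abs_rep[OF Quotient_sword, of x] that by metis

lemma sword_of_eq_1 [simp]: "sword_of w = 1 \<longleftrightarrow> w = []"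
  by (metis sword_eq.refl sword_eq_Nil sword_of_eq_iff sword_of_simps(1))

lemma opow_1 [simp]: "opow 1 q = 1"
  by transfer (simp add: sword_eq.refl)

lemma opow_Suc_left: "x * opow x q = opow x (q + 1)"
proof (transfer)
  fix x :: "'a zword" and q show "sword_eq (x @ zpow x q) (zpow x (q + 1))"
    using sword_eq.unfold_left[of x "q + 1"] by (cases "x = []") (auto intro: sword_eq.intros)
qed

lemma opow_Suc_right: "opow x q * x = opow x (q + 1)"
proof (transfer)
  fix x :: "'a zword" and q show "sword_eq (zpow x q @ x) (zpow x (q + 1))"
    using sword_eq.unfold_right[of x "q + 1"] by (cases "x = []") (auto intro: sword_eq.intros)
qed

lemma opow_shift: "x * opow (y * x) q = opow (x * y) q * x"
proof (cases "x = 1 \<or> y = 1")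
  case True
  then show ?thesis by (auto simp: opow_Suc_left opow_Suc_right)
next
  case False
  then show ?thesis
  proof transfer
    fix x y :: "'a zword" and q
    assume "\<not> (sword_eq x [] \<or> sword_eq y [])"
    then show "sword_eq (x @ zpow (y @ x) q) (zpow (x @ y) q @ x)"
      by (metis sword_eq.refl sword_eq.shift)
  qed
qed

lemma opow_left: "x ^ k * opow x q = opow x (q + int k)"
  by (induction k arbitrary: q) (simp_all add: mult.assoc opow_Suc_left add_ac)

lemma opow_right: "opow x q * x ^ k = opow x (q + int k)"
proof (induction k arbitrary: q)
  case (Suc k)
  have "opow x q * x ^ Suc k = (opow x q * x) * x ^ k" by (simp add: mult.assoc)
  also have "\<dots> = opow x (q + int (Suc k))" by (simp only: opow_Suc_right Suc) (simp add: add_ac)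
  finally show ?case .
qed simp

lemma opow_left_assoc: "x ^ k * (opow x q * y) = opow x (q + int k) * y"
  by (metis mult.assoc opow_left)

lemma opow_right_assoc: "opow x q * (x ^ k * y) = opow x (q + int k) * y"
  by (metis mult.assoc opow_right)

lemma opow_Suc_left_assoc: "x * (opow x q * y) = opow x (q + 1) * y"
  by (metis mult.assoc opow_Suc_left)

lemma opow_Suc_right_assoc: "opow x q * (x * y) = opow x (q + 1) * y"
  by (metis mult.assoc opow_Suc_right)

lemma power_shift: "x * (y * x) ^ k = (x * y) ^ k * x" for x y :: "'a::monoid_mult"
  by (induction k) (simp_all add: mult.assoc)

lemma power_conj: "(x * y) ^ Suc k = x * ((y * x) ^ k * y)" for x y :: "'a::monoid_mult"
  unfolding mult.assoc[symmetric] power_shift[of x y] power_Suc2 ..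

lemma power_comm: "x * (x ^ k * y) = x ^ k * (x * y)" for x y :: "'a::monoid_mult"
  by (metis mult.assoc power_commutes)

lemma sword_induct [case_names one letter opow times]:
  assumes 1: "P 1" and l: "\<And>a. P (letter a)"
    and o: "\<And>x q. x \<noteq> 1 \<Longrightarrow> P x \<Longrightarrow> P (opow x q)"
    and t: "\<And>x y. P x \<Longrightarrow> P y \<Longrightarrow> P (x * y)"
  shows "P x"
proof -
  have w: "P (sword_of w)" if "\<And>f. f \<in> set w \<Longrightarrow> P (sword_of [f])" for w
    using that
  proof (induction w)
    case (Cons f w)
    have "P (sword_of [f])" "P (sword_of w)" using Cons by auto
    then show ?case unfolding sword_of_Cons[of f w] by (rule t)
  qed (simp add: 1 sword_of_simps)
  have f: "P (sword_of [f])" for f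
  proof (induction f)
    case (Letter a) then show ?case by (simp add: sword_of_simps l)
  next
    case (Power a as q)
    have "P (sword_of (a # as))" by (rule w) (use Power in auto)
    then show ?case using o[of "sword_of (a # as)"] by (simp add: sword_of_Power)
  qed
  obtain w where "x = sword_of w" by (rule sword_of_surj)
  then show ?thesis using w f by simp
qed

lemma length_simps [simp]:
  "sword_length 1 = 0"
  "sword_length (letter a) = 1"
  "sword_length (opow x q) = [:q, 1:] * sword_length x"
  "sword_length (x * y) = sword_length x + sword_length y"
proof -
  obtain u v where "x = sword_of u" "y = sword_of v" by (metis sword_of_surj)
  then show "sword_length 1 = 0" "sword_length (letter a) = 1"
    "sword_length (opow x q) = [:q, 1:] * sword_length x"
    "sword_length (x * y) = sword_length x + sword_length y"
    by (simp_all only: sword_of_simps[symmetric] sword_length.abs_eq word_length_simps)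
qed

lemma length_power [simp]: "sword_length (x ^ k) = of_nat k * sword_length x"
  by (induction k) (simp_all add: algebra_simps)

lemma length_ge_0: "0 \<le> sword_length x"
proof (induction x rule: sword_induct)
  case (opow x q)
  have "[:q, 1:] \<ge> 0" by (simp add: int_poly_ge_iff)
  then show ?case using opow by (simp only: length_simps) (rule mult_nonneg_nonneg)
qed simp_all

lemma length_pos: "x \<noteq> 1 \<Longrightarrow> 0 < sword_length x"
proof (induction x rule: sword_induct)
  case (opow x q)
  have "[:q, 1:] > 0" by (simp add: less_poly_def pos_poly_def)
  then show ?case using mult_pos_pos[OF _ opow(2)[OF opow(1)]] by (simp only: length_simps)
next
  case (times x y)
  show ?case
  proof (cases "x = 1")
    case False
    then show ?thesis using times length_ge_0[of y] by (simp add: add_pos_nonneg)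
  qed (use times in auto)
qed simp_all

lemma length_eq_0 [simp]: "sword_length x = 0 \<longleftrightarrow> x = 1"
  using length_pos by force

lemma sword_mult_eq_1_iff: "x * y = 1 \<longleftrightarrow> x = 1 \<and> y = 1" for x y :: "'a sword"
  by (metis add_nonneg_eq_0_iff length_eq_0 length_ge_0 length_simps(4) mult_1)

lemma power_eq_1: "x ^ k = 1 \<longleftrightarrow> x = 1 \<or> k = 0" for x :: "'a sword"
  by (induction k) (auto simp: sword_mult_eq_1_iff)


section \<open>Equidivisibility\<close>

definition extend :: "'a sword \<Rightarrow> 'a sword \<Rightarrow> ('a sword \<times> 'a sword) set \<Rightarrow> ('a sword \<times> 'a sword) set" where
  "extend a b S = (\<lambda>(p, s). (a * p, s * b)) ` S"

text \<open>A cut of a formal power falls into a copy of the base that is finitely many copies away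
  from the left or from the right end. The copy that is cut no longer belongs to the remaining
  power, whence \<open>- 1\<close>.\<close>

definition pow_splits :: "('a sword \<times> 'a sword) set \<Rightarrow> 'a sword \<Rightarrow> int \<Rightarrow> ('a sword \<times> 'a sword) set" where
  "pow_splits S x q =
     (\<Union>k. extend (x ^ k) (opow x (q - int k - 1)) S) \<union>
     (\<Union>k. extend (opow x (q - int k - 1)) (x ^ k) S)"

definition conc_splits :: "('a sword \<times> 'a sword) set \<Rightarrow> 'a sword \<Rightarrow> 'a sword \<Rightarrow>
    ('a sword \<times> 'a sword) set \<Rightarrow> ('a sword \<times> 'a sword) set" where
  "conc_splits S x y T = extend 1 y S \<union> extend x 1 T"

lemma extendI: "(p, s) \<in> S \<Longrightarrow> (a * p, s * b) \<in> extend a b S"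
  unfolding extend_def by force

lemma mem_extend: "(u, v) \<in> extend a b S \<longleftrightarrow> (\<exists>p s. (p, s) \<in> S \<and> u = a * p \<and> v = s * b)"
  by (auto simp: extend_def)

lemma extend_simps:
  "extend a b (S \<union> T) = extend a b S \<union> extend a b T"
  "extend a b (\<Union>k::nat. F k) = (\<Union>k. extend a b (F k))"
  "extend a b (extend c d S) = extend (a * c) (d * b) S"
  "extend 1 1 S = S"
  unfolding extend_def by (auto simp: image_Un image_UN image_image mult.assoc case_prod_beta)

lemma UN_nat_unfold: "(\<Union>k. F k) = F 0 \<union> (\<Union>k. F (Suc k))"
  by (auto, metis not0_implies_Suc)

text \<open>The values are pairs of swords, not of words, so that invariance under
  \<open>sword_eq\<close> is an equality of sets.\<close>

function factor_splits :: "'a factor \<Rightarrow> ('a sword \<times> 'a sword) set"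
  and splits :: "'a zword \<Rightarrow> ('a sword \<times> 'a sword) set" where
  "factor_splits (Letter a) = {(1, letter a), (letter a, 1)}"
| "factor_splits (Power a as q) = pow_splits (splits (a # as)) (sword_of (a # as)) q"
| "splits [] = {(1, 1)}"
| "splits (f # w) = conc_splits (factor_splits f) (sword_of [f]) (sword_of w) (splits w)"
  by pat_completeness auto
termination
  by (relation "measure (case_sum (\<lambda>f. 2 * size f + 1) (\<lambda>w. 2 * size_list size w))") auto

declare factor_splits.simps [simp del] splits.simps [simp del]

lemma splits_trivial:
  fixes f :: "'a factor" and w :: "'a zword"
  shows "(1, sword_of [f]) \<in> factor_splits f \<and> (sword_of [f], 1) \<in> factor_splits f"
    "(1, sword_of w) \<in> splits w \<and> (sword_of w, 1) \<in> splits w"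
proof (induction f and w rule: factor_splits_splits.induct)
  case (2 a as q)
  let ?x = "sword_of (a # as)" and ?S = "splits (a # as)"
  have "(?x ^ 0 * 1, ?x * opow ?x (q - int 0 - 1)) \<in> extend (?x ^ 0) (opow ?x (q - int 0 - 1)) ?S"
    "(opow ?x (q - int 0 - 1) * ?x, 1 * ?x ^ 0) \<in> extend (opow ?x (q - int 0 - 1)) (?x ^ 0) ?S"
    using 2 by (blast intro: extendI)+
  then have "(?x ^ 0 * 1, ?x * opow ?x (q - int 0 - 1)) \<in> factor_splits (Power a as q)"
    "(opow ?x (q - int 0 - 1) * ?x, 1 * ?x ^ 0) \<in> factor_splits (Power a as q)"
    unfolding factor_splits.simps pow_splits_def by blast+
  then show ?case by (simp add: opow_Suc_left opow_Suc_right sword_of_Power)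
next
  case (4 f w)
  then have "(1 * 1, sword_of [f] * sword_of w) \<in> splits (f # w)"
    "(sword_of [f] * sword_of w, 1 * 1) \<in> splits (f # w)"
    unfolding splits.simps conc_splits_def by (blast intro: extendI)+
  then show ?case by (simp add: sword_of_Cons[of f w])
qed (simp_all add: factor_splits.simps splits.simps sword_of_simps)

lemma splits_singleton: "splits [f] = factor_splits f"
proof -
  have "extend 1 1 (factor_splits f) \<union> extend (sword_of [f]) 1 {(1, 1)} = factor_splits f"
    using splits_trivial(1)[of f] by (auto simp: extend_simps) (auto simp: extend_def)
  then show ?thesis by (simp add: splits.simps conc_splits_def sword_of_simps)
qed

lemma splits_zpow: "x \<noteq> [] \<Longrightarrow> splits (zpow x q) = pow_splits (splits x) (sword_of x) q"
  by (cases x) (simp_all add: splits_singleton factor_splits.simps)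

lemma conc_splits_assoc:
  "conc_splits (conc_splits S x y T) (x * y) z U = conc_splits S x (y * z) (conc_splits T y z U)"
  unfolding conc_splits_def by (simp add: extend_simps Un_assoc)

lemma splits_append: "splits (x @ y) = conc_splits (splits x) (sword_of x) (sword_of y) (splits y)"
proof (induction x)
  case Nil
  have "extend 1 (sword_of y) {(1, 1)} \<union> extend 1 1 (splits y) = splits y"
    using splits_trivial(2)[of y] by (auto simp: extend_simps) (auto simp: extend_def)
  then show ?case by (simp add: splits.simps conc_splits_def sword_of_simps)
next
  case (Cons f x)
  then show ?case
    by (simp add: splits.simps Cons sword_of_Cons[of f x] sword_of_simps conc_splits_assoc)
qed

lemma splits_sound:
  fixes f :: "'a factor" and w :: "'a zword"
  shows "(p, s) \<in> factor_splits f \<Longrightarrow> p * s = sword_of [f]"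
    "(p, s) \<in> splits w \<Longrightarrow> p * s = sword_of w"
proof (induction f and w arbitrary: p s and p s rule: factor_splits_splits.induct)
  case (2 a as q)
  have *: "p * (s * y) = sword_of (a # as) * y" if "(p, s) \<in> splits (a # as)" for p s y
    using 2(1)[OF that] by (metis mult.assoc)
  show ?case
    using 2(2) unfolding factor_splits.simps pow_splits_def extend_def sword_of_Power
    by (auto simp: mult.assoc * opow_left opow_right opow_Suc_left opow_Suc_right_assoc power_comm)
next
  case (4 f w)
  have *: "p * (s * y) = sword_of [f] * y" if "(p, s) \<in> factor_splits f" for p s y
    using 4(1)[OF that] by (metis mult.assoc)
  show ?case
    using 4(3) unfolding splits.simps conc_splits_def extend_def sword_of_Cons[of f w]
    by (auto simp: * 4(2) mult.assoc)
qed (auto simp: factor_splits.simps splits.simps sword_of_simps)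

text \<open>The cut in the unfolded copy becomes index 0 of the left family and shifts the other
  indices; in the right family the formal power absorbs the copy.\<close>

lemma conc_pow_splits_left:
  "conc_splits S x (opow x (q - 1)) (pow_splits S x (q - 1)) = pow_splits S x q"
proof -
  have "(\<Union>k. extend (x ^ k) (opow x (q - int k - 1)) S) =
      extend 1 (opow x (q - 1)) S \<union> (\<Union>k. extend (x * x ^ k) (opow x (q - 1 - int k - 1)) S)"
    by (subst UN_nat_unfold) (simp add: algebra_simps)
  then show ?thesis
    unfolding conc_splits_def pow_splits_def by (simp add: extend_simps opow_Suc_left Un_assoc)
qed

lemma conc_pow_splits_right:
  "conc_splits (pow_splits S x (q - 1)) (opow x (q - 1)) x S = pow_splits S x q"
proof -
  have "(\<Union>k. extend (opow x (q - int k - 1)) (x ^ k) S) =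
      extend (opow x (q - 1)) 1 S \<union> (\<Union>k. extend (opow x (q - 1 - int k - 1)) (x ^ k * x) S)"
    by (subst UN_nat_unfold) (simp add: algebra_simps power_commutes)
  then show ?thesis
    unfolding conc_splits_def pow_splits_def by (simp add: extend_simps opow_Suc_right Un_ac)
qed

text \<open>Cuts inside a \<open>y\<close> agree on both sides as they stand (\<open>?T1\<close>,
  \<open>?T2\<close>). Cuts inside an \<open>x\<close> agree once the isolated copy of
  \<open>x\<close> at the outer end is taken as index 0 of a family (\<open>?A\<close>,
  \<open>?B\<close>).\<close>

lemma conc_pow_splits_shift:
  "conc_splits S x (opow (y * x) q) (pow_splits (conc_splits T y x S) (y * x) q) =
   conc_splits (pow_splits (conc_splits S x y T) (x * y) q) (opow (x * y) q) x S" (is "?L = ?R")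
proof -
  have yox: "y * (opow (x * y) r * x) = opow (y * x) (r + 1)" for r
    unfolding opow_shift[of x y, symmetric] mult.assoc[symmetric] by (rule opow_Suc_left)
  have xoy: "x * (opow (y * x) r * y) = opow (x * y) (r + 1)" for r
    unfolding mult.assoc[symmetric] opow_shift[of x y] opow_Suc_right[symmetric] ..
  have ypx: "y * ((x * y) ^ k * x) = (y * x) ^ Suc k" for k
    unfolding power_shift[of x y, symmetric] mult.assoc[symmetric] by simp
  have xpy: "x * ((y * x) ^ k * y) = (x * y) ^ Suc k" for k
    unfolding mult.assoc[symmetric] power_shift[of x y] power_Suc2 ..
  let ?T1 = "\<Union>k. extend (x * (y * x) ^ k) (x * opow (y * x) (q - int k - 1)) T"
    and ?T2 = "\<Union>k. extend (x * opow (y * x) (q - int k - 1)) (x * (y * x) ^ k) T"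
  let ?A = "\<Union>k. extend ((x * y) ^ k) (y * (opow (x * y) (q - int k - 1) * x)) S"
    and ?B = "\<Union>k. extend (x * (opow (y * x) (q - int k - 1) * y)) ((y * x) ^ k) S"
  have a: "?A = extend 1 (opow (y * x) q) S \<union>
      (\<Union>k. extend (x * ((y * x) ^ k * y)) (opow (y * x) (q - int k - 1)) S)"
    unfolding yox xpy by (subst UN_nat_unfold) simp
  have b: "?B = extend (opow (x * y) q) 1 S \<union>
      (\<Union>k. extend (opow (x * y) (q - int k - 1)) (y * ((x * y) ^ k * x)) S)"
    unfolding xoy ypx by (subst UN_nat_unfold) simp
  have "?L = extend 1 (opow (y * x) q) S \<union> (?T1 \<union>
      (\<Union>k. extend (x * ((y * x) ^ k * y)) (opow (y * x) (q - int k - 1)) S) \<union> (?T2 \<union> ?B))"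
    unfolding conc_splits_def pow_splits_def by (simp add: extend_simps UN_Un_distrib mult.assoc)
  moreover have "?R = (?A \<union> ?T1) \<union>
      ((\<Union>k. extend (opow (x * y) (q - int k - 1)) (y * ((x * y) ^ k * x)) S) \<union> ?T2) \<union>
      extend (opow (x * y) q) 1 S"
    unfolding conc_splits_def pow_splits_def power_shift[of x y] opow_shift[of x y]
    by (simp add: extend_simps UN_Un_distrib mult.assoc)
  ultimately show ?thesis unfolding a b by (simp only: Un_ac)
qed

lemma splits_cong: "sword_eq u v \<Longrightarrow> splits u = splits v"
proof (induction rule: sword_eq.induct)
  case (conc x x' y y')
  then show ?case by (metis splits_append sword_of_eq_iff)
next
  case (pow x y q)
  then show ?case by (metis splits_zpow sword_of_eq_iff)
next
  case (unfold_left x q)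
  then show ?case by (simp add: splits_append splits_zpow sword_of_simps conc_pow_splits_left)
next
  case (unfold_right x q)
  then show ?case by (simp add: splits_append splits_zpow sword_of_simps conc_pow_splits_right)
next
  case (shift x y q)
  then show ?case by (simp add: splits_append splits_zpow sword_of_simps conc_pow_splits_shift)
qed auto

text \<open>The converse of soundness uses invariance: \<open>splits w\<close> can be computed from
  the representative \<open>p' @ s'\<close>, where the cut at the seam is present by
  construction.\<close>

lemma splits_iff: "(p, s) \<in> splits w \<longleftrightarrow> p * s = sword_of w"
proof
  assume *: "p * s = sword_of w"
  obtain p' s' where ps: "p = sword_of p'" "s = sword_of s'" by (metis sword_of_surj)
  then have "splits w = splits (p' @ s')"
    using * by (intro splits_cong) (metis sword_of_eq_iff sword_of_simps(2))
  moreover have "(1 * sword_of p', 1 * sword_of s') \<in> splits (p' @ s')"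
    unfolding splits_append conc_splits_def using splits_trivial(2) by (blast intro: extendI)
  ultimately show "(p, s) \<in> splits w" by (simp add: ps)
qed (rule splits_sound)

text \<open>The first cut lies at or before the second; \<open>t\<close> is the piece between
  them.\<close>

definition nested :: "'a sword \<Rightarrow> 'a sword \<Rightarrow> 'a sword \<Rightarrow> 'a sword \<Rightarrow> bool" where
  "nested p s p' s' \<longleftrightarrow> (\<exists>t. p' = p * t \<and> s = t * s')"

text \<open>The cuts are ordered as expected: the left family by its index, then the right family by
  decreasing index, and within one copy as in \<open>S\<close>.\<close>

lemma pow_splits_nested:
  assumes S: "\<And>p s. (p, s) \<in> S \<Longrightarrow> p * s = x"
    and n: "\<And>p s p' s'. (p, s) \<in> S \<Longrightarrow> (p', s') \<in> S \<Longrightarrow> nested p s p' s' \<or> nested p' s' p s"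
    and "(p1, s1) \<in> pow_splits S x q" "(p2, s2) \<in> pow_splits S x q"
  shows "nested p1 s1 p2 s2 \<or> nested p2 s2 p1 s1"
proof -
  have S': "p * (s * y) = x * y" if "(p, s) \<in> S" for p s y
    using S[OF that] by (metis mult.assoc)
  have lt: "nested (x ^ k * p) (s * opow x (q - int k - 1)) (x ^ l * p') (s' * opow x (q - int l - 1))"
    "nested (opow x (q - int l - 1) * p') (s' * x ^ l) (opow x (q - int k - 1) * p) (s * x ^ k)"
    if kl: "k < l" and ps: "(p, s) \<in> S" "(p', s') \<in> S" for k l p s p' s'
  proof -
    have pc: "x ^ i * (x ^ j * z) = x ^ j * (x ^ i * z)" for i j z
      by (metis add.commute mult.assoc power_add)
    have pc': "x ^ i * (x * x ^ j) = x ^ j * (x * x ^ i)" for i j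
      by (metis add_Suc_shift add.commute power_Suc power_add)
    from kl obtain d where d: "l = Suc (k + d)" using less_iff_Suc_add by auto
    \<comment> \<open>Between the cuts lie the rest of one copy, \<open>d\<close> whole copies and
      the beginning of another copy.\<close>
    show "nested (x ^ k * p) (s * opow x (q - int k - 1)) (x ^ l * p') (s' * opow x (q - int l - 1))"
      unfolding nested_def
      by (rule exI[of _ "s * (x ^ d * p')"])
        (use ps in \<open>simp add: d mult.assoc S' power_add power_comm pc opow_left opow_Suc_left opow_left_assoc algebra_simps\<close>)
    show "nested (opow x (q - int l - 1) * p') (s' * x ^ l) (opow x (q - int k - 1) * p) (s * x ^ k)"
      unfolding nested_def
      by (rule exI[of _ "s' * (x ^ d * p)"])
        (use ps pc'[of d k] in \<open>simp add: d mult.assoc S' S power_add power_comm opow_Suc_right_assoc opow_right_assoc algebra_simps\<close>)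
  qed
  have lr: "nested (x ^ k * p) (s * opow x (q - int k - 1)) (opow x (q - int l - 1) * p') (s' * x ^ l)"
    if ps: "(p, s) \<in> S" "(p', s') \<in> S" for k l p s p' s'
    unfolding nested_def
    \<comment> \<open>Taking away \<open>k\<close> and \<open>l\<close> whole copies and the two
      copies that are cut leaves the exponent with \<open>- 2\<close>.\<close>
    by (rule exI[of _ "s * (opow x (q - int k - int l - 2) * p')"])
      (use ps in \<open>simp add: mult.assoc S' opow_left_assoc opow_Suc_left_assoc opow_Suc_right_assoc opow_right opow_Suc_right algebra_simps\<close>)
  have eq: "nested (a * p) (s * b) (a * p') (s' * b)" if "nested p s p' s'" for a b p s p' s'
    using that unfolding nested_def by (auto simp: mult.assoc)
  have cs: "(\<exists>k p s. (p, s) \<in> S \<and> u = x ^ k * p \<and> v = s * opow x (q - int k - 1)) \<or>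
      (\<exists>k p s. (p, s) \<in> S \<and> u = opow x (q - int k - 1) * p \<and> v = s * x ^ k)"
    if "(u, v) \<in> pow_splits S x q" for u v
    using that by (simp add: pow_splits_def mem_extend)
  from cs[OF assms(3)] cs[OF assms(4)] show ?thesis
  proof (elim disjE exE conjE)
    fix k p s l p' s'
    assume h: "(p, s) \<in> S" "(p', s') \<in> S"
      "p1 = x ^ k * p" "s1 = s * opow x (q - int k - 1)"
      "p2 = x ^ l * p'" "s2 = s' * opow x (q - int l - 1)"
    show ?thesis
      using lt(1)[OF _ h(1,2), of k l] lt(1)[OF _ h(2,1), of l k] eq[of p s p' s'] eq[of p' s' p s] n[OF h(1,2)]
      unfolding h by (cases k l rule: linorder_cases) auto
  next
    fix k p s l p' s'
    assume h: "(p, s) \<in> S" "(p', s') \<in> S"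
      "p1 = x ^ k * p" "s1 = s * opow x (q - int k - 1)"
      "p2 = opow x (q - int l - 1) * p'" "s2 = s' * x ^ l"
    show ?thesis using lr[OF h(1,2)] unfolding h by simp
  next
    fix k p s l p' s'
    assume h: "(p, s) \<in> S" "(p', s') \<in> S"
      "p1 = opow x (q - int k - 1) * p" "s1 = s * x ^ k"
      "p2 = x ^ l * p'" "s2 = s' * opow x (q - int l - 1)"
    show ?thesis using lr[OF h(2,1)] unfolding h by simp
  next
    fix k p s l p' s'
    assume h: "(p, s) \<in> S" "(p', s') \<in> S"
      "p1 = opow x (q - int k - 1) * p" "s1 = s * x ^ k"
      "p2 = opow x (q - int l - 1) * p'" "s2 = s' * x ^ l"
    show ?thesis
      using lt(2)[OF _ h(1,2), of k l] lt(2)[OF _ h(2,1), of l k] eq[of p s p' s'] eq[of p' s' p s] n[OF h(1,2)]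
      unfolding h by (cases k l rule: linorder_cases) auto
  qed
qed

lemma splits_nested:
  fixes f :: "'a factor" and w :: "'a zword"
  shows
  "(p, s) \<in> factor_splits f \<Longrightarrow> (p', s') \<in> factor_splits f \<Longrightarrow> nested p s p' s' \<or> nested p' s' p s"
  "(p, s) \<in> splits w \<Longrightarrow> (p', s') \<in> splits w \<Longrightarrow> nested p s p' s' \<or> nested p' s' p s"
proof (induction f and w arbitrary: p s p' s' and p s p' s' rule: factor_splits_splits.induct)
  case (1 a)
  then show ?case by (auto simp: factor_splits.simps nested_def)
next
  case (2 a as q)
  show ?case
    by (rule pow_splits_nested[of "splits (a # as)" "sword_of (a # as)" p s q p' s'])
      (use 2 splits_sound(2) in \<open>auto simp: factor_splits.simps\<close>)
next
  case 3
  then show ?case by (auto simp: splits.simps nested_def)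
next
  case (4 f w)
  let ?f = "sword_of [f]" and ?w = "sword_of w"
  have a: "nested p s p' s' \<Longrightarrow> nested p (s * ?w) p' (s' * ?w)"
    "nested p s p' s' \<Longrightarrow> nested (?f * p) s (?f * p') s'" for p s p' s'
    unfolding nested_def by (auto simp: mult.assoc)
  have b: "nested p (s * ?w) (?f * p') s'" if "(p, s) \<in> factor_splits f" "(p', s') \<in> splits w" for p s p' s'
    unfolding nested_def
    by (rule exI[of _ "s * p'"])
      (metis mult.assoc splits_sound that)
  have cs: "(\<exists>r. (u, r) \<in> factor_splits f \<and> v = r * ?w) \<or>
      (\<exists>r. (r, v) \<in> splits w \<and> u = ?f * r)" if "(u, v) \<in> splits (f # w)" for u v
    using that by (auto simp: splits.simps conc_splits_def mem_extend)
  from cs[OF 4(3)] cs[OF 4(4)] show ?case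
    using 4(1,2) a b by (elim disjE exE conjE) (blast | simp)+
qed

section \<open>Equidivisibility and its consequences\<close>

lemma equidivisible:
  fixes x :: "'a sword"
  assumes "x * y = z * w"
  obtains t where "x = z * t" "w = t * y" | t where "z = x * t" "y = t * w"
proof -
  obtain v where "x * y = sword_of v" by (metis sword_of_surj)
  then have "(x, y) \<in> splits v" "(z, w) \<in> splits v" using assms by (simp_all add: splits_iff)
  from splits_nested(2)[OF this] show ?thesis using that unfolding nested_def by blast
qed

text \<open>Equidivisibility gives \<open>x = x * t\<close>, so \<open>t\<close> has length 0 and is
  empty.\<close>

lemma left_cancel [simp]: "x * y = x * z \<longleftrightarrow> y = z" for x :: "'a sword"
proof
  assume "x * y = x * z"
  then obtain t where "x = x * t" "y = t * z \<or> z = t * y" by (metis equidivisible)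
  moreover from this have "sword_length t = 0"
    by (metis add_cancel_left_right length_simps(4))
  ultimately show "y = z" by auto
qed simp

lemma equidivisible_le:
  fixes x :: "'a sword"
  assumes "x * y = z * w" "sword_length x \<le> sword_length z"
  obtains t where "z = x * t" "y = t * w"
proof (rule equidivisible[OF assms(1)])
  fix t assume t: "x = z * t" "w = t * y"
  then have "sword_length t \<le> 0" using assms(2) by simp
  then have "t = 1" using length_pos[of t] by fastforce
  then show ?thesis using t that[of 1] by simp
qed (use that in auto)

lemma equidivisible_power:
  fixes x :: "'a sword"
  assumes "p * s = x ^ k" "k > 0"
  obtains j p1 s1 where "x = p1 * s1" "p = x ^ j * p1" "s = s1 * x ^ (k - j - 1)" "j < k"
  using assms
proof (induction k arbitrary: p thesis)
  case (Suc k)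
  from Suc.prems(2) have "p * s = x * x ^ k" by simp
  then show ?case
  proof (cases rule: equidivisible)
    case (1 t)
    show ?thesis
    proof (cases "k = 0")
      case True
      then have "t = 1" "s = 1" using 1 by (simp_all add: sword_mult_eq_1_iff)
      then show ?thesis using Suc.prems(1)[of p 1 0] 1 True by simp
    next
      case False
      from Suc.IH[OF _ 1(2)[symmetric]] False
      obtain j p1 s1 where "x = p1 * s1" "t = x ^ j * p1" "s = s1 * x ^ (k - j - 1)" "j < k"
        by blast
      then show ?thesis using Suc.prems(1)[of p1 s1 "Suc j"] 1(1) by (simp add: mult.assoc)
    qed
  next
    case (2 t)
    then show ?thesis using Suc.prems(1)[of p t 0] by simp
  qed
qed simp

lemma cancel_same_length:
  assumes "a * b = c * d" "sword_length a = sword_length c"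
  shows "a = c" "b = d"
proof -
  from equidivisible_le[OF assms(1)] assms(2) obtain t where t: "c = a * t" "b = t * d" by auto
  then have "sword_length t = 0" using assms(2) by simp
  then show "a = c" "b = d" using t by simp_all
qed


section \<open>Normal swords\<close>

lemma sword_of_power: "sword_of (concat (replicate n w)) = sword_of w ^ n"
  by (induction n) (simp_all add: sword_of_simps)

lemma normal_factor:
  assumes "normal_sword (p * v * s)"
  shows "normal_sword v"
proof (rule ccontr)
  assume "\<not> normal_sword v"
  then obtain x y where xy: "sword_of x = v" "step_R x y"
    by (auto simp: normal_sword_def step_RS_def)
  obtain p' s' where "p = sword_of p'" "s = sword_of s'" by (metis sword_of_surj)
  then have "sword_of (p' @ x @ s') = p * v * s" using xy by (simp add: sword_of_simps mult.assoc)
  moreover have "step_R (p' @ x @ s') (p' @ y @ s')" using xy(2) by (rule step_R.conc)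
  ultimately show False using assms by (auto simp: normal_sword_def step_RS_def)
qed

lemma normal_prefix: "normal_sword (v * s) \<Longrightarrow> normal_sword v"
  using normal_factor[of 1 v s] by simp

lemma normal_suffix: "normal_sword (p * v) \<Longrightarrow> normal_sword v"
  using normal_factor[of p v 1] by simp

lemma not_normalI: "rule_R u v \<Longrightarrow> \<not> normal_sword (sword_of u)"
  by (auto simp: normal_sword_def step_RS_def intro: step_R.rule)

lemma not_normal_opow_opow: "x \<noteq> 1 \<Longrightarrow> \<not> normal_sword (opow x q * opow x r)"
  by (metis not_normalI rule_R.intros(1) sword_of_eq_1 sword_of_simps(2,3) sword_of_surj)

lemma not_normal_opow_power: "x \<noteq> 1 \<Longrightarrow> n \<ge> 2 \<Longrightarrow> \<not> normal_sword (opow (x ^ n) q)"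
  by (metis not_normalI rule_R.intros(2) sword_of_eq_1 sword_of_power sword_of_simps(3) sword_of_surj)

text \<open>What the base of a formal power in a normal sword satisfies, stated with finite powers
  only: the root in \<open>comm_lower\<close> has these properties before any formal power of it has
  been found.\<close>

definition good :: "'a sword \<Rightarrow> bool" where
  "good x \<longleftrightarrow> x \<noteq> 1 \<and> (\<forall>k. normal_sword (x ^ k)) \<and> (\<forall>z n. n \<ge> 2 \<longrightarrow> x \<noteq> z ^ n)"

lemma good_opow_base:
  assumes "normal_sword (opow x q)" "x \<noteq> 1"
  shows "good x"
  unfolding good_def
proof (intro conjI allI impI)
  fix k
  have "opow x q = x ^ k * opow x (q - int k)" by (simp add: opow_left)
  then show "normal_sword (x ^ k)" using assms(1) by (metis normal_prefix)
next
  fix z n assume "n \<ge> (2::nat)"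
  then show "x \<noteq> z ^ n" using assms not_normal_opow_power[of z n q] by (auto simp: power_eq_1)
qed fact

text \<open>The square of \<open>opow z r\<close> is reducible, since its two powers merge.\<close>

lemma good_not_opow: "good x \<Longrightarrow> x \<noteq> opow z r"
proof
  assume x: "good x" "x = opow z r"
  then have "z \<noteq> 1" by (auto simp: good_def)
  moreover have "normal_sword (x ^ 2)" using x(1) by (simp add: good_def)
  ultimately show False using x(2) not_normal_opow_opow[of z r r] by (simp add: power2_eq_square)
qed

text \<open>Powers of \<open>s * p\<close> are factors of powers of \<open>p * s\<close>. A root of
  \<open>s * p\<close>, cut where \<open>s\<close> ends, turns into a conjugate root of
  \<open>p * s\<close> with the same exponent.\<close>

lemma good_conj:
  assumes "good (p * s)"
  shows "good (s * p)"
  unfolding good_def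
proof (intro conjI allI impI)
  show "s * p \<noteq> 1" using assms by (auto simp: good_def sword_mult_eq_1_iff)
  fix k
  have "p * (s * p) ^ k * s = (p * s) ^ Suc k" unfolding power_conj mult.assoc ..
  then show "normal_sword ((s * p) ^ k)" using assms by (metis good_def normal_factor)
next
  fix z and n :: nat assume n: "n \<ge> 2"
  show "s * p \<noteq> z ^ n"
  proof
    assume "s * p = z ^ n"
    moreover have "0 < n" using n by simp
    ultimately obtain i a b where "z = a * b" "s = z ^ i * a" "p = b * z ^ (n - i - 1)" "i < n"
      by (rule equidivisible_power)
    moreover from this have "n = Suc (n - i - 1 + i)" by simp
    ultimately have "p * s = b * (z ^ (n - i - 1) * z ^ i) * a" by (simp add: mult.assoc)
    also have "\<dots> = b * (z ^ (n - i - 1 + i)) * a" by (simp only: power_add)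
    also have "\<dots> = (b * a) ^ Suc (n - i - 1 + i)"
      unfolding \<open>z = a * b\<close> power_conj[of b a] mult.assoc ..
    also have "\<dots> = (b * a) ^ n" using \<open>n = _\<close> by simp
    finally show False using assms n by (auto simp: good_def)
  qed
qed


section \<open>Heights as degrees of lengths\<close>

text \<open>Agrees with the height on non-empty swords; the empty sword gets 0 instead of
  \<open>Minf\<close>.\<close>

definition ht :: "'a sword \<Rightarrow> nat" where
  "ht x = degree (sword_length x)"

text \<open>Used only for \<open>ht x \<le> e\<close>, where \<open>nat\<close> loses nothing;
  coefficients below the degree may be negative, because exponents \<open>\<omega> + q\<close> with
  \<open>q < 0\<close> occur.\<close>

definition top_coeff :: "nat \<Rightarrow> 'a sword \<Rightarrow> nat" where
  "top_coeff e x = nat (coeff (sword_length x) e)"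

lemma int_poly_pos_iff: "0 < f \<longleftrightarrow> 0 < lead_coeff f" for f :: "int poly"
  by (simp add: less_poly_def pos_poly_def)

lemma int_poly_less_degree:
  fixes f g :: "int poly"
  assumes "0 < g" "degree f < degree g"
  shows "f < g"
proof -
  have "degree (g - f) = degree g"
    using assms(2) degree_add_eq_left[of "- f" g] by simp
  moreover have "coeff (g - f) (degree g) = lead_coeff g" using assms(2) by (simp add: coeff_eq_0)
  ultimately have "0 < g - f" using assms(1) by (simp only: int_poly_pos_iff)
  then show ?thesis by simp
qed

lemma int_poly_archimedean:
  fixes f g :: "int poly"
  assumes "0 < g" "degree f \<le> degree g"
  shows "\<exists>k. f < of_nat k * g"
proof -
  \<comment> \<open>As \<open>lead_coeff g\<close> is at least 1, this many copies of
    \<open>g\<close> outweigh the coefficient of \<open>f\<close> at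
    \<open>degree g\<close>.\<close>
  define k where "k = nat (\<bar>coeff f (degree g)\<bar> + 1)"
  have g: "0 < lead_coeff g" using assms(1) by (simp add: int_poly_pos_iff)
  have c: "coeff (of_nat k * g - f) (degree g) = int k * lead_coeff g - coeff f (degree g)"
    by (simp add: of_nat_poly)
  have "\<bar>coeff f (degree g)\<bar> + 1 \<le> int k * lead_coeff g"
    using g mult_left_mono[of 1 "lead_coeff g" "int k"] by (simp add: k_def)
  then have pos: "0 < coeff (of_nat k * g - f) (degree g)" using c by linarith
  have "degree (of_nat k * g - f) \<le> degree g"
    using assms(2) by (intro degree_diff_le) (simp_all add: of_nat_poly)
  then have "degree (of_nat k * g - f) = degree g" using pos le_degree[of "of_nat k * g - f" "degree g"] by linarith
  then have "0 < of_nat k * g - f" using pos by (simp only: int_poly_pos_iff)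
  then show ?thesis by auto
qed

lemma length_lead_pos: "x \<noteq> 1 \<Longrightarrow> 0 < lead_coeff (sword_length x)"
  using length_pos[of x] by (simp add: int_poly_pos_iff)

lemma coeff_length_nonneg: "ht x \<le> e \<Longrightarrow> 0 \<le> coeff (sword_length x) e"
proof (cases "x = 1")
  case False
  assume "ht x \<le> e"
  then show ?thesis using length_lead_pos[OF False] by (cases "ht x = e") (auto simp: ht_def coeff_eq_0)
qed simp

lemma ht_1 [simp]: "ht 1 = 0"
  by (simp add: ht_def)

lemma ht_letter [simp]: "ht (letter a) = 0"
  by (simp add: ht_def)

lemma ht_opow: "x \<noteq> 1 \<Longrightarrow> ht (opow x q) = Suc (ht x)"
  unfolding ht_def length_simps by (subst degree_mult_eq) simp_all

lemma ht_mult [simp]: "ht (x * y) = max (ht x) (ht y)"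
proof (cases "x = 1 \<or> y = 1")
  case False
  show ?thesis
  proof (cases "ht x" "ht y" rule: linorder_cases)
    case equal
    have "0 < coeff (sword_length x + sword_length y) (ht x)"
      using False equal length_lead_pos[of x] length_lead_pos[of y] by (simp add: ht_def)
    then have "ht x \<le> degree (sword_length x + sword_length y)" by (intro le_degree) simp
    moreover have "degree (sword_length x + sword_length y) \<le> ht x"
      using equal by (intro degree_add_le) (simp_all add: ht_def)
    ultimately show ?thesis using equal by (simp add: ht_def)
  qed (simp_all add: ht_def degree_add_eq_left degree_add_eq_right)
qed auto

lemma ht_power_le: "ht (x ^ k) \<le> ht x"
  by (induction k) auto

lemma ht_power [simp]: "k > 0 \<Longrightarrow> ht (x ^ k) = ht x"
  by (cases k) (simp_all add: max_absorb1 ht_power_le)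

lemma length_less_of_ht: "ht x < ht y \<Longrightarrow> sword_length x < sword_length y"
  by (rule int_poly_less_degree) (auto simp: ht_def intro: length_pos)

lemma ht_mono: "sword_length x \<le> sword_length y \<Longrightarrow> ht x \<le> ht y"
  using length_less_of_ht[of y x] by (meson leD leI)

lemma length_power_unbounded:
  assumes "x \<noteq> 1" "ht y \<le> ht x"
  obtains k where "sword_length y < sword_length (x ^ k)"
proof -
  have "\<exists>k. sword_length y < of_nat k * sword_length x"
    by (rule int_poly_archimedean) (use assms length_pos in \<open>simp_all add: ht_def\<close>)
  then show ?thesis using that unfolding length_power by blast
qed

lemma length_factor_le: "sword_length x \<le> sword_length (x * y)" "sword_length y \<le> sword_length (x * y)"
  using length_ge_0[of x] length_ge_0[of y] by simp_all

lemma top_coeff_mult: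
  "ht x \<le> e \<Longrightarrow> ht y \<le> e \<Longrightarrow> top_coeff e (x * y) = top_coeff e x + top_coeff e y"
  unfolding top_coeff_def by (simp add: coeff_length_nonneg nat_add_distrib)

lemma top_coeff_pos: "x \<noteq> 1 \<Longrightarrow> top_coeff (ht x) x > 0"
  using length_lead_pos[of x] by (simp add: top_coeff_def ht_def)

text \<open>Picks the first formal power whose base has height \<open>e\<close>. In a power with a
  higher base, one copy is unfolded and the search continues inside it.\<close>

lemma decompose:
  assumes "e < ht u"
  obtains w x q v where "u = w * opow x q * v" "ht w \<le> e" "ht x = e" "x \<noteq> 1"
proof -
  have "e < ht u \<Longrightarrow> \<exists>w x q v. u = w * opow x q * v \<and> ht w \<le> e \<and> ht x = e \<and> x \<noteq> 1"
  proof (induction u rule: sword_induct)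
    case (opow x q)
    show ?case
    proof (cases "ht x = e")
      case True
      have "opow x q = 1 * opow x q * 1" by simp
      then show ?thesis using True opow(1) by (metis ht_1 le0)
    next
      case False
      then have "e < ht x" using opow by (simp add: ht_opow)
      then obtain w y r v where *: "x = w * opow y r * v" "ht w \<le> e" "ht y = e" "y \<noteq> 1"
        using opow by blast
      have "opow x q = x * opow x (q - 1)" by (simp add: opow_Suc_left)
      also have "\<dots> = w * opow y r * (v * opow x (q - 1))" by (subst (1) *(1)) (simp add: mult.assoc)
      finally show ?thesis using * by blast
    qed
  next
    case (times x y)
    show ?case
    proof (cases "e < ht x")
      case True
      then show ?thesis using times by (metis mult.assoc)
    next
      case False
      then have "e < ht y" using times(3) by auto
      then obtain w z r v where "y = w * opow z r * v" "ht w \<le> e" "ht z = e" "z \<noteq> 1"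
        using times by blast
      then have "x * y = (x * w) * opow z r * v" "ht (x * w) \<le> e" "ht z = e" "z \<noteq> 1"
        using False by (simp_all add: mult.assoc)
      then show ?thesis by blast
    qed
  qed simp_all
  then show ?thesis using assms that by blast
qed


section \<open>Commuting swords\<close>

definition comparable :: "'a sword \<Rightarrow> 'a sword \<Rightarrow> bool" where
  "comparable x y \<longleftrightarrow> (\<exists>t. x = y * t \<or> y = x * t)"

lemma comparable_sym: "comparable x y \<Longrightarrow> comparable y x"
  by (auto simp: comparable_def)

lemma comparable_cancel [simp]: "comparable (w * x) (w * y) \<longleftrightarrow> comparable x y"
  by (simp add: comparable_def mult.assoc)

lemma comparable_prefixes: "x * y = z * w \<Longrightarrow> comparable x z"
  by (metis comparable_def equidivisible)

lemma comparable_prefix: "comparable (x * y) z \<Longrightarrow> comparable x z"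
  by (metis comparable_def comparable_prefixes mult.assoc)

lemma comparable_le:
  assumes "comparable x y" "sword_length x \<le> sword_length y"
  obtains t where "y = x * t"
  using assms(1) unfolding comparable_def
proof (elim exE disjE)
  fix t assume "x = y * t"
  then show ?thesis using equidivisible_le[of x 1 y t] assms(2) that by auto
qed (use that in blast)

text \<open>Products of two formal powers of \<open>z\<close> are left out: they are reducible and
  cannot occur in normal swords.\<close>

definition cyc :: "'a sword \<Rightarrow> 'a sword set" where
  "cyc z = range (\<lambda>n. z ^ n) \<union> range (opow z)"

lemma cyc_mult:
  assumes "x \<in> cyc z" "y \<in> cyc z" "z \<noteq> 1" "normal_sword (x * y)"
  shows "x * y \<in> cyc z"
  using assms not_normal_opow_opow[of z] unfolding cyc_def
  by (auto simp: opow_left opow_right simp flip: power_add)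

text \<open>A predicate, so that the lemmas below can assume it while it is still being proved by
  induction; the \<open>itself\<close> argument fixes the alphabet.\<close>

definition comm_le :: "nat \<Rightarrow> 'a itself \<Rightarrow> bool" where
  "comm_le e _ \<longleftrightarrow> (\<forall>x y :: 'a sword. x * y = y * x \<longrightarrow> normal_sword (x * y) \<longrightarrow> ht (x * y) \<le> e \<longrightarrow>
     (\<exists>z. z \<noteq> 1 \<and> x \<in> cyc z \<and> y \<in> cyc z))"

text \<open>The product lies in \<open>cyc z\<close> and is not a formal power, so both factors are
  finite powers of \<open>z\<close>; primitivity of the product bounds the sum of the exponents by
  1.\<close>

lemma good_not_comm:
  fixes x y :: "'a sword"
  assumes c: "comm_le e TYPE('a)" and "x * y = y * x" "good (x * y)" "ht (x * y) \<le> e"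
  shows "x = 1 \<or> y = 1"
proof (rule ccontr)
  assume n: "\<not> (x = 1 \<or> y = 1)"
  have no: "normal_sword (x * y)" using assms(3) by (metis good_def power_one_right)
  then obtain z where z: "z \<noteq> 1" "x \<in> cyc z" "y \<in> cyc z"
    using c assms unfolding comm_le_def by blast
  then have "x * y \<in> cyc z" using no cyc_mult by blast
  then have "x * y \<notin> range (opow z)" using good_not_opow[OF assms(3)] by blast
  then obtain i j where "x = z ^ i" "y = z ^ j"
    using z no not_normal_opow_opow[of z] by (auto simp: cyc_def opow_left opow_right)
  then show False
    using n assms(3) unfolding good_def
    by (metis One_nat_def Suc_1 add_mono_thms_linordered_semiring(1) not_less_eq_eq le_zero_eq one_add_one power_0 power_add)
qed

text \<open>Let the longer sword be \<open>x = y * d\<close>. Some power of \<open>y\<close> has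
  both \<open>y * d\<close> and, since \<open>x ^ 2\<close> continues after its first
  \<open>y\<close> with \<open>d * y\<close>, also \<open>d * y\<close> as a prefix. Equal lengths
  give \<open>y * d = d * y\<close>, and goodness of \<open>x\<close> forces
  \<open>d = 1\<close>.\<close>

lemma good_powers_comparable:
  fixes x y :: "'a sword"
  assumes c: "comm_le e TYPE('a)" and g: "good x" "good y" "ht x = e" "ht y = e"
    and "\<And>k l. comparable (x ^ k) (y ^ l)"
  shows "x = y"
proof -
  have *: "x = y" if g: "good x" "ht x = e" "ht y = e" and cmp: "\<And>k l. comparable (x ^ k) (y ^ l)"
    and le: "sword_length y \<le> sword_length x" and y1: "y \<noteq> 1" for x y :: "'a sword"
  proof -
    have "comparable y x" using cmp[of 1 1] by (simp add: comparable_sym)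
    then obtain d where d: "x = y * d" using le by (rule comparable_le)
    obtain l where l: "sword_length x < sword_length (y ^ l)"
      using length_power_unbounded[of y x] g y1 by auto
    have "comparable (y * (d * (y * d))) (y * y ^ l)"
      using cmp[of 2 "Suc l"] by (simp add: d mult.assoc power2_eq_square)
    then have "comparable (d * y) (y ^ l)"
      by (metis comparable_cancel comparable_prefix mult.assoc)
    moreover have dx: "sword_length (d * y) = sword_length x" by (simp add: d)
    ultimately obtain t where t: "y ^ l = d * y * t" using l by (metis comparable_le less_imp_le)
    obtain t' where "y ^ l = y * d * t'" using cmp[of 1 l] l by (metis comparable_le d less_imp_le power_one_right)
    then have "y * d = d * y" using t cancel_same_length(1)[of "y * d" t' "d * y" t] by simp
    then have "y = 1 \<or> d = 1" using good_not_comm[OF c, of y d] g d by simp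
    then show ?thesis using y1 d by simp
  qed
  show ?thesis
  proof (cases "sword_length y \<le> sword_length x")
    case True
    then show ?thesis using * assms by (metis good_def)
  next
    case False
    then show ?thesis using *[of y x] assms comparable_sym by (metis good_def linear)
  qed
qed

text \<open>Some power of \<open>x\<close> is longer than \<open>t\<close>, so \<open>t\<close> ends
  inside a copy of \<open>x\<close> and cuts it into \<open>p\<close> and \<open>s\<close>. Behind
  \<open>t\<close>, powers of \<open>x\<close> continue as powers of the conjugate
  \<open>s * p\<close>, which are comparable with those of \<open>z\<close>.\<close>

lemma fine_wilf:
  fixes x z :: "'a sword"
  assumes c: "comm_le e TYPE('a)" and g: "good x" "good z" "ht x = e" "ht z = e" "ht t \<le> e"
    and cmp: "\<And>k l. comparable (x ^ k) (t * z ^ l)"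
  obtains p s j where "x = p * s" "z = s * p" "t = x ^ j * p"
proof -
  have "x \<noteq> 1" using g by (simp add: good_def)
  then obtain k where k: "sword_length t < sword_length (x ^ k)"
    using length_power_unbounded[of x t] g by auto
  then have "k > 0" using length_ge_0[of t] by (cases k) auto
  have "comparable t (x ^ k)" using cmp[of k 0] by (simp add: comparable_sym)
  then obtain s' where "t * s' = x ^ k" using k by (metis comparable_le less_imp_le)
  then obtain j p s where jps: "x = p * s" "t = x ^ j * p"
    using \<open>k > 0\<close> by (rule equidivisible_power)
  have "comparable ((s * p) ^ i) (z ^ l)" for i l
  proof -
    have "x ^ (j + Suc i) = (x ^ j * p) * ((s * p) ^ i * s)"
      unfolding power_add jps(1) power_conj by (simp add: mult.assoc)
    then have "comparable ((x ^ j * p) * ((s * p) ^ i * s)) ((x ^ j * p) * z ^ l)"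
      using cmp[of "j + Suc i" l] jps(2) by metis
    then show ?thesis using comparable_prefix by auto
  qed
  moreover have "good (s * p)" "ht (s * p) = e"
    using g jps(1) good_conj by (auto simp: max.commute)
  ultimately have "s * p = z" using good_powers_comparable[OF c _ g(2) _ g(4)] by blast
  then show ?thesis using that jps by blast
qed

text \<open>The prefixes \<open>g ^ k\<close> push the height of \<open>x\<close> above that of
  \<open>g\<close>. The first formal power in \<open>x\<close> with a base of the height of
  \<open>g\<close> has, by \<open>fine_wilf\<close>, a base conjugate to \<open>g\<close>; shifting
  makes it a power of \<open>g\<close> itself.\<close>

lemma absorb:
  fixes g x :: "'a sword"
  assumes c: "comm_le (ht g) TYPE('a)" and g: "good g" and x: "normal_sword x"
    and pre: "\<And>k. \<exists>t. x = g ^ k * t"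
  obtains q y where "x = opow g q * y"
proof -
  have "ht g < ht x"
  proof (rule ccontr)
    assume "\<not> ht g < ht x"
    then obtain k where "sword_length x < sword_length (g ^ k)"
      using length_power_unbounded[of g x] g by (auto simp: good_def)
    then show False using pre[of k] length_factor_le(1) by (metis leD)
  qed
  then obtain w z r v where d: "x = w * opow z r * v" "ht w \<le> ht g" "ht z = ht g" "z \<noteq> 1"
    by (rule decompose)
  have "good z" using x d(1,4) good_opow_base normal_factor by blast
  moreover have "comparable (g ^ k) (w * z ^ l)" for k l
  proof -
    obtain t where "x = g ^ k * t" using pre by blast
    moreover have "opow z r = z ^ l * opow z (r - int l)" by (simp add: opow_left)
    then have "x = (w * z ^ l) * (opow z (r - int l) * v)" using d(1) by (simp add: mult.assoc)
    ultimately show ?thesis by (metis comparable_prefixes)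
  qed
  ultimately obtain p s j where j: "g = p * s" "z = s * p" "w = g ^ j * p"
    using fine_wilf[OF c g _ HOL.refl d(3,2)] by metis
  have "x = g ^ j * (p * opow (s * p) r) * v" using d(1) j by (simp add: mult.assoc)
  also have "\<dots> = opow g (r + int j) * (p * v)"
    unfolding opow_shift by (simp add: j(1)[symmetric] mult.assoc opow_left_assoc)
  finally show ?thesis using that by blast
qed

text \<open>A proper root has the same height and a smaller leading coefficient, so taking roots
  stops.\<close>

lemma primitive_root:
  assumes "y \<noteq> (1 :: 'a sword)"
  obtains g n where "y = g ^ n" "n > 0" "\<And>z m. m \<ge> 2 \<Longrightarrow> g \<noteq> z ^ m"
proof -
  have "\<exists>g n. y = g ^ n \<and> n > 0 \<and> (\<forall>z m. m \<ge> 2 \<longrightarrow> g \<noteq> z ^ m)"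
    using assms
  proof (induction "top_coeff (ht y) y" arbitrary: y rule: less_induct)
    case less
    show ?case
    proof (cases "\<exists>z m. m \<ge> 2 \<and> y = z ^ m")
      case False
      then have "y = y ^ 1 \<and> (1::nat) > 0 \<and> (\<forall>z m. m \<ge> 2 \<longrightarrow> y \<noteq> z ^ m)" by auto
      then show ?thesis by blast
    next
      case True
      then obtain z m where zm: "m \<ge> 2" "y = z ^ m" by blast
      then obtain i where i: "m = Suc i" "i > 0" by (cases m) auto
      have z: "z \<noteq> 1" using zm less by (auto simp: power_eq_1)
      have "ht y = ht z" using zm by simp
      have "top_coeff (ht z) (z * z ^ i) = top_coeff (ht z) z + top_coeff (ht z) (z ^ i)"
        using i by (intro top_coeff_mult) simp_all
      moreover have "top_coeff (ht z) (z ^ i) > 0"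
        using top_coeff_pos[of "z ^ i"] z i by (simp add: power_eq_1)
      ultimately have "top_coeff (ht z) z < top_coeff (ht y) y" using zm i \<open>ht y = ht z\<close> by simp
      then obtain g n where "z = g ^ n" "n > 0" "\<forall>z m. m \<ge> 2 \<longrightarrow> g \<noteq> z ^ m"
        using less(1) z by blast
      then have "y = g ^ (n * m) \<and> n * m > 0 \<and> (\<forall>z m. m \<ge> 2 \<longrightarrow> g \<noteq> z ^ m)"
        using zm by (auto simp: power_mult)
      then show ?thesis by blast
    qed
  qed
  then show ?thesis using that by blast
qed

text \<open>All powers of \<open>y\<close> are prefixes of the higher \<open>x\<close>, so
  \<open>x\<close> absorbs a formal power of the primitive root \<open>g\<close> of
  \<open>y\<close>. By normality the rest \<open>x'\<close> cannot absorb another one, hence it is a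
  prefix of a power of \<open>g\<close>; as it commutes with \<open>g ^ n\<close>, it is itself a
  power of \<open>g\<close>.\<close>

lemma comm_lower:
  fixes x y :: "'a sword"
  assumes c: "comm_le (ht y) TYPE('a)" and xy: "x * y = y * x" and no: "normal_sword x"
    and h: "ht y < ht x" and "y \<noteq> 1"
  shows "\<exists>z. z \<noteq> 1 \<and> x \<in> cyc z \<and> y \<in> cyc z"
proof -
  obtain g n where g: "y = g ^ n" "n > 0" "\<And>z m. m \<ge> 2 \<Longrightarrow> g \<noteq> z ^ m"
    using primitive_root[OF \<open>y \<noteq> 1\<close>] by metis
  have hg: "ht g = ht y" using g by simp
  have g1: "g \<noteq> 1" using g \<open>y \<noteq> 1\<close> by auto
  have pow: "y ^ k = g ^ k * g ^ (n * k - k)" for k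
    using g(1,2) by (simp flip: power_mult power_add)
  have pre: "\<exists>t. x = g ^ k * t" for k
  proof -
    have "y ^ k * x = x * y ^ k" using power_commuting_commutes[of y x k] xy by simp
    moreover have "ht (y ^ k) < ht x" using h ht_power_le[of y k] by linarith
    ultimately obtain t where "x = y ^ k * t"
      using equidivisible_le length_less_of_ht less_imp_le by metis
    then show ?thesis using pow[of k] by (metis mult.assoc)
  qed
  have gg: "good g"
    unfolding good_def using g1 g(3) pre no by (metis normal_prefix)
  obtain q x' where q: "x = opow g q * x'"
    using absorb[OF _ gg no pre] c hg by metis
  have "opow g q * (x' * g ^ n) = opow g q * (g ^ n * x')"
    using xy unfolding q g(1) mult.assoc opow_left_assoc opow_right_assoc .
  then have comm: "x' * g ^ n = g ^ n * x'" by simp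
  have "\<exists>k. \<forall>t. x' \<noteq> g ^ k * t"
  proof (rule ccontr)
    assume "\<not> ?thesis"
    then obtain r v where "x' = opow g r * v"
      using absorb[of g x'] c hg gg no q normal_suffix by metis
    then have "normal_sword (opow g q * opow g r)" using no q by (metis mult.assoc normal_prefix)
    then show False using not_normal_opow_opow[OF g1] by blast
  qed
  then obtain k where k: "x' \<noteq> g ^ k * t" for t by blast
  have "y ^ k * x' = x' * y ^ k"
    using power_commuting_commutes[of y x' k] comm g(1) by simp
  then have "\<exists>t. y ^ k = x' * t"
  proof (cases rule: equidivisible)
    case (2 t)
    then show ?thesis using k pow[of k] by (metis mult.assoc)
  qed blast
  then obtain t where "x' * t = g ^ (n * k)" using g(1) by (auto simp: power_mult)
  moreover have "n * k > 0" using k[of x'] g(2) by (cases k) auto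
  ultimately obtain i p s where ips: "g = p * s" "x' = g ^ i * p" by (rule equidivisible_power)
  have "g ^ i * (p * g ^ n) = g ^ i * (g ^ n * p)"
    using comm unfolding ips(2) by (metis mult.assoc power_add add.commute)
  then have "p * g ^ n = g ^ n * p" by simp
  moreover obtain m where m: "n = Suc m" using g(2) by (cases n) auto
  moreover
  have "g ^ n * p = p * (s * p) ^ Suc m"
    unfolding m ips(1) power_conj[of p s] unfolding power_Suc2 mult.assoc ..
  \<comment> \<open>After cancelling \<open>p\<close>, the two sides begin with \<open>s * p\<close>
    and \<open>p * s\<close>, which have equal length.\<close>
  ultimately have "s * p * (s * p) ^ m = p * s * (p * s) ^ m" using m ips(1) by simp
  then have "s * p = p * s" by (rule cancel_same_length) simp
  then have "p = 1 \<or> s = 1"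
    using good_not_comm[OF c, of p s] gg hg ips(1) by (metis order_refl)
  then have "\<exists>j. x' = g ^ j"
  proof
    assume "s = 1"
    then have "x' = g ^ Suc i" using ips by (simp only: power_Suc2) simp
    then show ?thesis ..
  qed (use ips in auto)
  then have "x \<in> cyc g" using q by (auto simp: opow_right cyc_def)
  moreover have "y \<in> cyc g" using g(1) by (auto simp: cyc_def)
  ultimately show ?thesis using g1 by blast
qed

text \<open>Euclidean subtraction: if the shorter \<open>y\<close> also has height \<open>e\<close>,
  then \<open>x = y * t = t * y\<close>, and the pair \<open>y\<close>, \<open>t\<close> has the
  normal product \<open>x\<close> and a smaller sum of coefficients.\<close>

lemma comm_step:
  fixes x y :: "'a sword"
  assumes c: "\<And>e'. e' < e \<Longrightarrow> comm_le e' TYPE('a)"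
    and "x * y = y * x" "normal_sword (x * y)" "ht (x * y) = e"
  shows "\<exists>z. z \<noteq> 1 \<and> x \<in> cyc z \<and> y \<in> cyc z"
  using assms(2-4)
proof (induction "top_coeff e x + top_coeff e y" arbitrary: x y rule: less_induct)
  case less
  \<comment> \<open>The case of a shorter \<open>y\<close>; the induction hypothesis is an
    assumption here because the case is also applied with \<open>x\<close> and \<open>y\<close>
    exchanged.\<close>
  have *: "\<exists>z. z \<noteq> 1 \<and> x \<in> cyc z \<and> y \<in> cyc z"
    if IH: "\<And>x' y' :: 'a sword. top_coeff e x' + top_coeff e y' < top_coeff e x + top_coeff e y \<Longrightarrow>
          x' * y' = y' * x' \<Longrightarrow> normal_sword (x' * y') \<Longrightarrow> ht (x' * y') = e \<Longrightarrow>
          \<exists>z. z \<noteq> 1 \<and> x' \<in> cyc z \<and> y' \<in> cyc z"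
      and xy: "x * y = y * x" and no: "normal_sword (x * y)" and h: "ht (x * y) = e"
      and le: "sword_length y \<le> sword_length x" for x y :: "'a sword"
  proof -
    obtain t where t: "x = y * t" "x = t * y" using equidivisible_le[OF xy[symmetric] le] by blast
    have hx: "ht x = e" using ht_mono[OF le] h by simp
    have nx: "normal_sword x" using no by (rule normal_prefix)
    consider "y = 1" "x = 1" | "y = 1" "x \<noteq> 1" | "y \<noteq> 1" "ht y < e" | "y \<noteq> 1" "ht y = e"
      using ht_mono[OF le] hx by linarith
    then show ?thesis
    proof cases
      case 1
      \<comment> \<open>Two empty swords are zeroth powers of anything; a letter supplies the
        non-empty root.\<close>
      have "letter undefined \<noteq> (1 :: 'a sword)" by (metis length_eq_0 length_simps(2) zero_neq_one)
      moreover have "(1 :: 'a sword) = z ^ 0" for z by simp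
      ultimately show ?thesis using 1 unfolding cyc_def by blast
    next
      case 2
      have "y = x ^ 0" "x = x ^ 1" using 2 by simp_all
      then show ?thesis using 2(2) unfolding cyc_def by blast
    next
      case 3
      then show ?thesis using comm_lower[OF c xy nx] hx by simp
    next
      case 4
      have "top_coeff e x = top_coeff e y + top_coeff e t"
        using hx unfolding t(1) by (intro top_coeff_mult) simp_all
      moreover have "top_coeff e y > 0" using 4 top_coeff_pos[of y] by simp
      ultimately have "\<exists>z. z \<noteq> 1 \<and> y \<in> cyc z \<and> t \<in> cyc z"
        using t nx hx by (intro IH) simp_all
      then show ?thesis using t(1) nx cyc_mult by metis
    qed
  qed
  show ?case
  proof (cases "sword_length y \<le> sword_length x")
    case True
    show ?thesis by (rule *) (use less True in auto)
  next
    case False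
    have "\<exists>z. z \<noteq> 1 \<and> y \<in> cyc z \<and> x \<in> cyc z"
      by (rule *) (use less False in \<open>auto simp: max.commute add.commute\<close>)
    then show ?thesis by blast
  qed
qed

lemma comm_le_all: "comm_le e TYPE('a)"
proof (induction e rule: less_induct)
  case (less e)
  show ?case
    unfolding comm_le_def
  proof (intro allI impI)
    fix x y :: "'a sword"
    assume *: "x * y = y * x" "normal_sword (x * y)" "ht (x * y) \<le> e"
    show "\<exists>z. z \<noteq> 1 \<and> x \<in> cyc z \<and> y \<in> cyc z"
      by (rule comm_step[OF less *(1,2) HOL.refl]) (use *(3) in linarith)
  qed
qed


section \<open>First letters\<close>

text \<open>A formal power starts with a copy of its base, whatever the sign of \<open>q\<close>, so
  first letters exist even there.\<close>

lemma sword_cases: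
  obtains "x = 1" | a y where "x = letter a * y"
proof -
  have "x = 1 \<or> (\<exists>a y. x = letter a * y)"
  proof (induction x rule: sword_induct)
    case (letter a)
    have "letter a = letter a * 1" by simp
    then show ?case by blast
  next
    case (opow x q)
    then obtain a y where "x = letter a * y" by blast
    then have "opow x q = letter a * (y * opow x (q - 1))"
      using opow_Suc_left[of x "q - 1"] by (metis diff_add_cancel mult.assoc)
    then show ?case by blast
  next
    case (times x y)
    then show ?case by (metis mult.assoc mult_1)
  qed simp
  then show ?thesis using that by blast
qed

text \<open>An invariant of \<open>sword_eq\<close> that tells the classes of different letters
  apart.\<close>

definition letters :: "'a zword \<Rightarrow> 'a set" where
  "letters w = (\<Union>f\<in>set w. set_factor f)"

lemma letters_simps [simp]:
  "letters [] = {}"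
  "letters [Letter a] = {a}"
  "letters (x @ y) = letters x \<union> letters y"
  "letters (zpow x q) = letters x"
  by (auto simp: letters_def) (cases x; auto)+

lemma sword_eq_letters: "sword_eq u v \<Longrightarrow> letters u = letters v"
  by (induction rule: sword_eq.induct) auto

lemma letter_neq_1 [simp]: "letter a \<noteq> 1"
  by (metis length_eq_0 length_simps(2) zero_neq_one)

lemma letter_eq_iff [simp]: "letter a = letter b \<longleftrightarrow> a = b"
  by (metis letters_simps(2) singleton_inject sword_eq_letters sword_of_eq_iff sword_of_simps(4))

lemma letter_mult_eq: "letter a * x = letter b * y \<Longrightarrow> a = b"
  using cancel_same_length(1)[of "letter a" x "letter b" y] by simp


section \<open>Longest common prefixes\<close>

definition branches :: "'a sword \<Rightarrow> 'a sword \<Rightarrow> bool" where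
  "branches a b \<longleftrightarrow> a = 1 \<or> b = 1 \<or>
     (\<exists>c d a' b'. c \<noteq> d \<and> a = letter c * a' \<and> b = letter d * b')"

definition has_lcp :: "'a sword \<Rightarrow> 'a sword \<Rightarrow> bool" where
  "has_lcp u v \<longleftrightarrow> (\<exists>t a b. u = t * a \<and> v = t * b \<and> branches a b)"

lemma branches_sym: "branches a b \<Longrightarrow> branches b a"
  unfolding branches_def by metis

lemma branches_no_prefix:
  assumes "branches (x * a) (x * b)"
  shows "x = 1"
proof (cases x rule: sword_cases)
  case (2 c y)
  then show ?thesis
    using assms letter_mult_eq unfolding branches_def
    by (metis mult.assoc sword_mult_eq_1_iff letter_neq_1)
qed

text \<open>A common prefix at least as long as \<open>t\<close> extends \<open>t\<close> by a
  common prefix of the remainders, which is empty. This yields uniqueness along with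
  maximality.\<close>

lemma branches_lcp:
  assumes u: "u = t * a" and v: "v = t * b" and ab: "branches a b"
  shows "longest_common_prefix u v t"
  unfolding longest_common_prefix_def
proof (intro conjI allI impI)
  show "common_prefix u v t" using u v by (auto simp: common_prefix_def sword_prefix_def)
  fix p assume p: "common_prefix u v p \<and> p \<noteq> t"
  then obtain x y where xy: "u = p * x" "v = p * y"
    by (auto simp: common_prefix_def sword_prefix_def)
  show "sword_length p < sword_length t"
  proof (rule ccontr)
    assume "\<not> ?thesis"
    then have le: "sword_length t \<le> sword_length p" by simp
    obtain r where r: "p = t * r" "a = r * x"
      using equidivisible_le[of t a p x] le u xy by metis
    have "b = r * y" using v xy(2) r(1) by (simp add: mult.assoc)
    then have "r = 1" using branches_no_prefix ab r(2) by blast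
    then show False using p r by simp
  qed
qed

lemma has_lcp_sym: "has_lcp u v \<Longrightarrow> has_lcp v u"
  unfolding has_lcp_def using branches_sym by metis

lemma has_lcp_mult: "has_lcp u v \<Longrightarrow> has_lcp (w * u) (w * v)"
  unfolding has_lcp_def by (metis mult.assoc)

lemma has_lcp_comparable: "comparable u v \<Longrightarrow> has_lcp u v"
  unfolding has_lcp_def comparable_def branches_def by (metis mult_1_right)

text \<open>Without comparability neither remainder is empty, so they differ in their first letters
  and whatever follows is irrelevant.\<close>

lemma has_lcp_extend:
  assumes "has_lcp u v" "\<not> comparable u v"
  shows "has_lcp (u * u') (v * v')"
proof -
  obtain t a b where t: "u = t * a" "v = t * b" "branches a b"
    using assms(1) by (auto simp: has_lcp_def)
  have "a \<noteq> 1" "b \<noteq> 1" using assms(2) t by (auto simp: comparable_def)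
  then obtain c d a' b' where "c \<noteq> d" "a = letter c * a'" "b = letter d * b'"
    using t(3) by (auto simp: branches_def)
  then have "u * u' = t * (letter c * (a' * u'))" "v * v' = t * (letter d * (b' * v'))" "c \<noteq> d"
    using t by (simp_all add: mult.assoc)
  then show ?thesis unfolding has_lcp_def branches_def by blast
qed

text \<open>The case in which finite powers never separate the two formal powers: by
  \<open>fine_wilf\<close> and shifting, \<open>v\<close> too is \<open>w\<close> followed by a
  formal power of \<open>x\<close>.\<close>

lemma has_lcp_step:
  fixes u v :: "'a sword"
  assumes uv: "u = w * opow x q * u'" "v = (w * t) * opow z r * v'"
    and no: "normal_sword u" "normal_sword v" and h: "ht u \<le> Suc e" "ht v \<le> Suc e"
    and e: "ht t \<le> e" "ht x = e" "ht z = e" "x \<noteq> 1" "z \<noteq> 1"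
    and cmp: "\<And>k l. comparable (w * x ^ k) (w * t * z ^ l)"
    and IH: "\<And>u' v' :: 'a sword. normal_sword u' \<Longrightarrow> normal_sword v' \<Longrightarrow> ht u' \<le> Suc e \<Longrightarrow> ht v' \<le> Suc e \<Longrightarrow>
        top_coeff (Suc e) u' + top_coeff (Suc e) v' < top_coeff (Suc e) u + top_coeff (Suc e) v \<Longrightarrow>
        has_lcp u' v'"
  shows "has_lcp u v"
proof -
  have g: "good x" "good z" using uv no e good_opow_base normal_factor by metis+
  have "comparable (x ^ k) (t * z ^ l)" for k l
    using cmp[of k l] by (simp add: mult.assoc)
  then obtain p s j where j: "x = p * s" "z = s * p" "t = x ^ j * p"
    using fine_wilf[OF comm_le_all g e(2,3,1)] by metis
  have "v = w * (x ^ j * ((p * opow (s * p) r) * v'))" using uv(2) j by (simp add: mult.assoc)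
  then have v: "v = w * (opow x (r + int j) * (p * v'))"
    unfolding opow_shift by (simp add: j(1)[symmetric] mult.assoc opow_left_assoc)
  have u: "u = w * (opow x q * u')" using uv(1) by (simp add: mult.assoc)
  \<comment> \<open>With the smaller exponent, what remains of either power of \<open>x\<close> is a
    finite power.\<close>
  define m where "m = min q (r + int j)"
  define a where "a = x ^ nat (q - m) * u'"
  define b where "b = x ^ nat (r + int j - m) * (p * v')"
  have ua: "u = (w * opow x m) * a" and vb: "v = (w * opow x m) * b"
    unfolding u v a_def b_def by (simp_all add: mult.assoc opow_right_assoc m_def)
  have ab: "normal_sword a" "normal_sword b" using no ua vb normal_suffix by metis+
  have hts: "ht a \<le> Suc e" "ht b \<le> Suc e" "ht (w * opow x m) \<le> Suc e" using h ua vb by simp_all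
  have "ht (w * opow x m) = Suc e" "w * opow x m \<noteq> 1"
    using e(2,4) hts(3) by (auto simp: ht_opow sword_mult_eq_1_iff) (metis Zero_not_Suc ht_1 ht_opow)
  \<comment> \<open>The cancelled prefix has full height, so removing it lowers the measure.\<close>
  then have "top_coeff (Suc e) (w * opow x m) > 0" using top_coeff_pos by metis
  then have "has_lcp a b"
    using ab hts by (intro IH) (simp_all only: ua vb top_coeff_mult)
  then show ?thesis unfolding ua vb by (rule has_lcp_mult)
qed

text \<open>The prefix \<open>w * x ^ k\<close> of \<open>u\<close> has height at most
  \<open>e\<close> and is longer than \<open>v\<close> for large \<open>k\<close>, so comparing it
  with \<open>v\<close> settles the question.\<close>

lemma has_lcp_lower:
  fixes u v :: "'a sword"
  assumes IH: "\<And>u v :: 'a sword. normal_sword u \<Longrightarrow> normal_sword v \<Longrightarrow> ht u \<le> e \<Longrightarrow> ht v \<le> e \<Longrightarrow> has_lcp u v"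
    and no: "normal_sword u" "normal_sword v" and h: "e < ht u" "ht v \<le> e"
  shows "has_lcp u v"
proof -
  obtain w x q u' where u: "u = w * opow x q * u'" "ht w \<le> e" "ht x = e" "x \<noteq> 1"
    using h(1) by (rule decompose)
  obtain k where k: "sword_length v < sword_length (x ^ k)"
    using length_power_unbounded[of x v] u h by auto
  have u': "u = (w * x ^ k) * (opow x (q - int k) * u')"
    using u(1) by (simp add: mult.assoc opow_left_assoc)
  then have "normal_sword (w * x ^ k)" using no normal_prefix by metis
  moreover have "ht (w * x ^ k) \<le> e" using u ht_power_le[of x k] by simp
  ultimately have lcp: "has_lcp (w * x ^ k) v" using IH no h by blast
  show ?thesis
  proof (cases "comparable (w * x ^ k) v")
    case True
    have "sword_length v \<le> sword_length (w * x ^ k)"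
      using k length_factor_le(2)[of "x ^ k" w] by (meson less_imp_le order_trans)
    then obtain t where "w * x ^ k = v * t" using True comparable_sym comparable_le by metis
    then have "comparable u v" unfolding u' comparable_def by (metis mult.assoc)
    then show ?thesis by (rule has_lcp_comparable)
  next
    case False
    then show ?thesis using has_lcp_extend[OF lcp, of _ 1] u' by simp
  qed
qed

lemma normal_has_lcp_ht:
  fixes u v :: "'a sword"
  assumes "normal_sword u" "normal_sword v" "ht u \<le> e" "ht v \<le> e"
  shows "has_lcp u v"
  using assms
proof (induction e arbitrary: u v)
  case 0
  then show ?case
  proof (induction "top_coeff 0 u + top_coeff 0 v" arbitrary: u v rule: less_induct)
    case less
    \<comment> \<open>At height 0 the measure counts letters; a common first letter is
      removed.\<close>
    consider "u = 1 \<or> v = 1" | c a d b where "u = letter c * a" "v = letter d * b"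
      by (metis sword_cases)
    then show ?case
    proof cases
      case 1
      then show ?thesis unfolding has_lcp_def branches_def by (metis mult_1)
    next
      case 2
      show ?thesis
      proof (cases "c = d")
        case False
        have "u = 1 * u" "v = 1 * v" by simp_all
        then show ?thesis unfolding has_lcp_def branches_def using 2 False by blast
      next
        case True
        have "has_lcp a b"
        proof (rule less.hyps)
          have "top_coeff 0 (letter c :: 'a sword) > 0" using top_coeff_pos[of "letter c"] by simp
          then show "top_coeff 0 a + top_coeff 0 b < top_coeff 0 u + top_coeff 0 v"
            using less.prems 2 by (simp add: top_coeff_mult)
        qed (use less.prems 2 normal_suffix in auto)
        then show ?thesis using 2 True has_lcp_mult by blast
      qed
    qed
  qed
next
  case (Suc e)
  note lower = Suc.IH
  from Suc.prems show ?case
  proof (induction "top_coeff (Suc e) u + top_coeff (Suc e) v" arbitrary: u v rule: less_induct)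
    case less
    consider "ht u \<le> e" "ht v \<le> e" | "e < ht u" "ht v \<le> e" | "ht u \<le> e" "e < ht v"
      | "e < ht u" "e < ht v" by linarith
    then show ?case
    proof cases
      case 1
      then show ?thesis using lower less.prems by blast
    next
      case 2
      then show ?thesis using has_lcp_lower[OF lower] less.prems by blast
    next
      case 3
      then show ?thesis using has_lcp_lower[OF lower] less.prems has_lcp_sym by blast
    next
      case 4
      obtain w x q u' where u: "u = w * opow x q * u'" "ht w \<le> e" "ht x = e" "x \<noteq> 1"
        using 4(1) by (rule decompose)
      obtain y z r v' where v: "v = y * opow z r * v'" "ht y \<le> e" "ht z = e" "z \<noteq> 1"
        using 4(2) by (rule decompose)
      have ext: "u = (w * x ^ k) * (opow x (q - int k) * u')" "v = (y * z ^ k) * (opow z (r - int k) * v')" for k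
        using u v by (simp_all add: mult.assoc opow_left_assoc)
      then have nf: "normal_sword (w * x ^ k)" "normal_sword (y * z ^ k)" for k
        using less.prems normal_prefix by metis+
      have hts: "ht (w * x ^ k) \<le> e" "ht (y * z ^ k) \<le> e" for k
        using u v ht_power_le[of x k] ht_power_le[of z k] by simp_all
      show ?thesis
      proof (cases "\<forall>k l. comparable (w * x ^ k) (y * z ^ l)")
        case False
        then obtain k l where "\<not> comparable (w * x ^ k) (y * z ^ l)" by blast
        then show ?thesis
          using has_lcp_extend[of "w * x ^ k" "y * z ^ l"] lower nf hts ext by metis
      next
        case True
        have "comparable w y" using True[rule_format, of 0 0] by simp
        then consider t where "y = w * t" | t where "w = y * t" unfolding comparable_def by blast
        then show ?thesis
        proof cases
          case (1 t)
          show ?thesis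
            by (rule has_lcp_step[of u w x q u' v t z r v' e])
              (use u v 1 less True in auto)
        next
          case (2 t)
          have "has_lcp v u"
            by (rule has_lcp_step[of v y z r v' u t x q u' e])
              (use u v 2 less True in \<open>auto simp: comparable_sym add.commute intro: has_lcp_sym\<close>)
          then show ?thesis by (rule has_lcp_sym)
        qed
      qed
    qed
  qed
qed

lemma normal_has_lcp: "normal_sword u \<Longrightarrow> normal_sword v \<Longrightarrow> has_lcp u v"
  by (rule normal_has_lcp_ht[of _ _ "max (ht u) (ht v)"]) auto

section \<open>Computable functions of one argument\<close>

definition pair :: "nat \<Rightarrow> nat \<Rightarrow> nat" where "pair a b = prod_encode (a, b)"
definition pfst :: "nat \<Rightarrow> nat" where "pfst z = fst (prod_decode z)"
definition psnd :: "nat \<Rightarrow> nat" where "psnd z = snd (prod_decode z)"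

lemma pair_simps [simp]: "pfst (pair a b) = a" "psnd (pair a b) = b" "pair (pfst z) (psnd z) = z"
  by (simp_all add: pair_def pfst_def psnd_def)

definition add_recf where "add_recf = PrimRec (Proj 0) (Comp Succ [Proj 1])"
definition pred_recf where "pred_recf = PrimRec Zero (Proj 0)"
text \<open>The recursion variable comes first, so the arguments are exchanged:
  \<open>[n, m]\<close> gives \<open>m - n\<close>.\<close>

definition sub_recf where "sub_recf = PrimRec (Proj 0) (Comp pred_recf [Proj 1])"
definition tri_recf where "tri_recf = PrimRec Zero (Comp Succ [Comp add_recf [Proj 0, Proj 1]])"
definition pair_recf where "pair_recf = Comp add_recf [Comp tri_recf [add_recf], Proj 0]"
definition root_recf where
  "root_recf = PrimRec Zero (Comp add_recf [Proj 1,
     Comp sub_recf [Comp sub_recf [Comp Succ [Proj 0], Comp tri_recf [Comp Succ [Proj 1]]],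
       Comp Succ [Zero]]])"
definition fst_recf where "fst_recf = Comp sub_recf [Comp tri_recf [root_recf], Proj 0]"
definition snd_recf where "snd_recf = Comp sub_recf [fst_recf, root_recf]"

text \<open>The index of the Cantor diagonal that contains the argument. The truncated difference
  adds 1 exactly when the next triangular number is reached.\<close>

primrec tri_root :: "nat \<Rightarrow> nat" where
  "tri_root 0 = 0"
| "tri_root (Suc m) = tri_root m + (1 - (triangle (Suc (tri_root m)) - Suc m))"

lemma tri_root: "triangle (tri_root z) \<le> z \<and> z < triangle (Suc (tri_root z))"
proof (induction z)
  case (Suc m)
  show ?case
  proof (cases "triangle (Suc (tri_root m)) \<le> Suc m")
    case True
    then have "triangle (Suc (tri_root m)) = Suc m" using Suc by simp
    then show ?thesis by simp
  next
    case False
    then have "tri_root (Suc m) = tri_root m" by (simp del: triangle_Suc)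
    then show ?thesis using False Suc by (simp del: tri_root.simps triangle_Suc)
  qed
qed simp

lemma pair_tri_root: "pair (z - triangle (tri_root z)) (tri_root z - (z - triangle (tri_root z))) = z"
  using tri_root[of z] by (simp add: pair_def prod_encode_def)

lemma pfst_eq: "pfst z = z - triangle (tri_root z)"
  by (subst (1) pair_tri_root[of z, symmetric]) (simp only: pair_simps)

lemma psnd_eq: "psnd z = tri_root z - pfst z"
  unfolding pfst_eq by (subst (1) pair_tri_root[of z, symmetric]) (simp only: pair_simps)

lemma eval_add [simp]: "eval_recf add_recf [m, n] = Some (m + n)"
  unfolding add_recf_def by (induction m) simp_all

lemma eval_pred [simp]: "eval_recf pred_recf [n] = Some (n - 1)"
  unfolding pred_recf_def by (induction n) simp_all

lemma eval_sub [simp]: "eval_recf sub_recf [n, m] = Some (m - n)"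
  unfolding sub_recf_def by (induction n) simp_all

lemma eval_tri [simp]: "eval_recf tri_recf [n] = Some (triangle n)"
  unfolding tri_recf_def by (induction n) simp_all

lemma eval_pair [simp]: "eval_recf pair_recf [m, n] = Some (pair m n)"
  by (simp add: pair_recf_def pair_def prod_encode_def)

lemma eval_root [simp]: "eval_recf root_recf [n] = Some (tri_root n)"
  unfolding root_recf_def by (induction n) simp_all

lemma eval_fst [simp]: "eval_recf fst_recf [n] = Some (pfst n)"
  by (simp add: fst_recf_def pfst_eq)

lemma eval_snd [simp]: "eval_recf snd_recf [n] = Some (psnd n)"
  by (simp add: snd_recf_def psnd_eq)

text \<open>Further arguments are packed with \<open>pair\<close>, so the closure rules need no
  arities.\<close>

definition computable :: "(nat \<Rightarrow> nat) \<Rightarrow> bool" where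
  "computable f \<longleftrightarrow> (\<exists>r. \<forall>x. eval_recf r [x] = Some (f x))"

named_theorems computable

lemma computableI: "(\<And>x. eval_recf r [x] = Some (f x)) \<Longrightarrow> computable f"
  unfolding computable_def by blast

lemma computableE:
  assumes "computable f"
  obtains r where "\<And>x. eval_recf r [x] = Some (f x)"
  using assms unfolding computable_def by blast

lemma computable_id [computable]: "computable (\<lambda>x. x)"
  by (rule computableI[of "Proj 0"]) simp

lemma computable_comp: "computable f \<Longrightarrow> computable g \<Longrightarrow> computable (\<lambda>x. f (g x))"
proof (elim computableE)
  fix r s assume "\<And>x. eval_recf r [x] = Some (f x)" "\<And>x. eval_recf s [x] = Some (g x)"
  then show ?thesis by (intro computableI[of "Comp r [s]"]) simp
qed

lemma computable_binary:
  assumes "\<And>m n. eval_recf b [m, n] = Some (op m n)" "computable f" "computable g"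
  shows "computable (\<lambda>x. op (f x) (g x))"
  using assms(2,3)
proof (elim computableE)
  fix r s assume "\<And>x. eval_recf r [x] = Some (f x)" "\<And>x. eval_recf s [x] = Some (g x)"
  then show ?thesis using assms(1) by (intro computableI[of "Comp b [r, s]"]) simp
qed

lemma computable_Suc [computable]: "computable f \<Longrightarrow> computable (\<lambda>x. Suc (f x))"
  by (rule computable_comp) (rule computableI[of Succ], simp)

lemma computable_const [computable]: "computable (\<lambda>x. k)"
proof (induction k)
  case 0
  show ?case by (rule computableI[of Zero]) simp
qed (rule computable_Suc)

lemma computable_add [computable]: "computable f \<Longrightarrow> computable g \<Longrightarrow> computable (\<lambda>x. f x + g x)"
  by (rule computable_binary[OF eval_add])

lemma computable_diff [computable]: "computable f \<Longrightarrow> computable g \<Longrightarrow> computable (\<lambda>x. f x - g x)"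
  by (rule computable_binary[OF eval_sub, where f = g and g = f])

lemma computable_pair [computable]: "computable f \<Longrightarrow> computable g \<Longrightarrow> computable (\<lambda>x. pair (f x) (g x))"
  by (rule computable_binary[OF eval_pair])

lemma computable_pfst [computable]: "computable f \<Longrightarrow> computable (\<lambda>x. pfst (f x))"
  by (rule computable_comp) (rule computableI[OF eval_fst])

lemma computable_psnd [computable]: "computable f \<Longrightarrow> computable (\<lambda>x. psnd (f x))"
  by (rule computable_comp) (rule computableI[OF eval_snd])

lemma computable_curry:
  assumes "computable (\<lambda>e. op (pfst e) (psnd e))" "computable f" "computable g"
  shows "computable (\<lambda>x. op (f x) (g x))"
  using computable_comp[OF assms(1) computable_pair[OF assms(2,3)]] by simp

lemma computable_rec:
  assumes "computable a" "computable (\<lambda>e. s (pfst e) (pfst (psnd e)) (psnd (psnd e)))" "computable n"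
  shows "computable (\<lambda>x. rec_nat (a x) (s x) (n x))"
  using assms
proof (elim computableE)
  fix ra rs rn
  assume a: "\<And>x. eval_recf ra [x] = Some (a x)" and n: "\<And>x. eval_recf rn [x] = Some (n x)"
    and s: "\<And>e. eval_recf rs [e] = Some (s (pfst e) (pfst (psnd e)) (psnd (psnd e)))"
  define p where "p = PrimRec ra (Comp rs [Comp pair_recf [Proj 2, Comp pair_recf [Proj 0, Proj 1]]])"
  have "eval_recf p [k, x] = Some (rec_nat (a x) (s x) k)" for k x
    unfolding p_def by (induction k) (simp_all add: a s)
  then show ?thesis
    by (intro computableI[of "Comp p [rn, Proj 0]"]) (simp add: n)
qed

text \<open>Truth is 0 because \<open>Mu\<close> searches for a zero.\<close>

definition decidable :: "(nat \<Rightarrow> bool) \<Rightarrow> bool" where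
  "decidable P \<longleftrightarrow> computable (\<lambda>x. if P x then 0 else 1)"

lemma computable_if [computable]:
  assumes "decidable P" "computable f" "computable g"
  shows "computable (\<lambda>x. if P x then f x else g x)"
proof -
  have "computable (\<lambda>x. rec_nat (f x) (\<lambda>_ _. g x) (if P x then 0 else 1))"
    using assms unfolding decidable_def
    by (intro computable_rec computable_comp[OF assms(3)] computable)
  then show ?thesis by (rule back_subst[of computable]) auto
qed

lemma decidable_eq [computable]:
  assumes "computable f" "computable g"
  shows "decidable (\<lambda>x. f x = g x)"
proof -
  \<comment> \<open>The sum of the two truncated differences vanishes only for equal values;
    \<open>1 - (1 - _)\<close> reduces it to 0 or 1.\<close>
  have "computable (\<lambda>x. 1 - (1 - ((f x - g x) + (g x - f x))))" by (intro computable assms)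
  then show ?thesis unfolding decidable_def by (rule back_subst[of computable]) auto
qed

lemma decidable_not [computable]:
  assumes "decidable P"
  shows "decidable (\<lambda>x. \<not> P x)"
proof -
  have "computable (\<lambda>x. if P x then 1 else 0)" by (intro computable assms)
  then show ?thesis unfolding decidable_def by (rule back_subst[of computable]) auto
qed

lemma decidable_conj [computable]:
  assumes "decidable P" "decidable Q"
  shows "decidable (\<lambda>x. P x \<and> Q x)"
proof -
  have "computable (\<lambda>x. if P x then (if Q x then 0 else 1) else 1)" by (intro computable assms)
  then show ?thesis unfolding decidable_def by (rule back_subst[of computable]) auto
qed

lemma decidable_disj [computable]:
  assumes "decidable P" "decidable Q"
  shows "decidable (\<lambda>x. P x \<or> Q x)"
proof -
  have "computable (\<lambda>x. if P x then 0 else (if Q x then 0 else 1))" by (intro computable assms)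
  then show ?thesis unfolding decidable_def by (rule back_subst[of computable]) auto
qed

lemma decidable_imp [computable]: "decidable P \<Longrightarrow> decidable Q \<Longrightarrow> decidable (\<lambda>x. P x \<longrightarrow> Q x)"
  unfolding imp_conv_disj by (intro computable)

lemma decidable_comp: "decidable P \<Longrightarrow> computable f \<Longrightarrow> decidable (\<lambda>x. P (f x))"
  unfolding decidable_def by (rule computable_comp)

lemma decidable_curry:
  assumes "decidable (\<lambda>e. P (pfst e) (psnd e))" "computable f" "computable g"
  shows "decidable (\<lambda>x. P (f x) (g x))"
  using decidable_comp[OF assms(1) computable_pair[OF assms(2,3)]] by simp

lemma decidable_ex_less:
  assumes "decidable (\<lambda>e. P (pfst e) (psnd e))" "computable b"
  shows "decidable (\<lambda>x. \<exists>i<b x. P x i)"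
proof -
  have "computable (\<lambda>x. rec_nat 1 (\<lambda>i r. if P x i then 0 else r) (b x))"
    by (intro computable_rec computable assms decidable_curry[OF assms(1)])
  moreover have "rec_nat 1 (\<lambda>i r. if P x i then 0 else r) k = (if \<exists>i<k. P x i then 0 else (1::nat))" for x k
    by (induction k) (auto simp: less_Suc_eq)
  ultimately show ?thesis unfolding decidable_def by simp
qed

lemma decidable_all_less:
  assumes "decidable (\<lambda>e. P (pfst e) (psnd e))" "computable b"
  shows "decidable (\<lambda>x. \<forall>i<b x. P x i)"
proof -
  have "decidable (\<lambda>x. \<not> (\<exists>i<b x. \<not> P x i))"
    by (intro decidable_not decidable_ex_less assms)
  then show ?thesis by simp
qed

lemma decidable_bex_list:
  "(\<And>c. c \<in> set cs \<Longrightarrow> decidable (P c)) \<Longrightarrow> decidable (\<lambda>x. \<exists>c\<in>set cs. P c x)"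
proof (induction cs)
  case Nil
  have "decidable (\<lambda>x. (0::nat) = 1)" by (intro computable)
  then show ?case by simp
next
  case (Cons c cs)
  then have "decidable (\<lambda>x. P c x \<or> (\<exists>c\<in>set cs. P c x))" by (intro decidable_disj) auto
  then show ?case by simp
qed

lemma decidable_ball_list:
  assumes "\<And>c. c \<in> set cs \<Longrightarrow> decidable (P c)"
  shows "decidable (\<lambda>x. \<forall>c\<in>set cs. P c x)"
proof -
  have "decidable (\<lambda>x. \<not> (\<exists>c\<in>set cs. \<not> P c x))"
    by (intro decidable_not decidable_bex_list assms)
  then show ?thesis by simp
qed

lemma even_eq_rec: "even n \<longleftrightarrow> rec_nat 0 (\<lambda>_ r. 1 - r) n = (0::nat)"
proof -
  have "rec_nat 0 (\<lambda>_ r. 1 - r) n = (if even n then 0 else (1::nat))" by (induction n) auto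
  then show ?thesis by simp
qed

lemma decidable_even [computable]:
  assumes "computable f"
  shows "decidable (\<lambda>x. even (f x))"
  unfolding even_eq_rec by (intro computable computable_rec assms)

text \<open>The tested predicate has a total program, so minimization ends as soon as a witness
  exists; the result is a component of the least witness.\<close>

lemma search:
  assumes "decidable P"
  obtains f where "\<And>u v. \<exists>n. P (pair n (pair u v)) \<Longrightarrow>
    \<exists>n. P (pair n (pair u v)) \<and> eval_recf f [u, v] = Some (pfst n)"
proof -
  obtain r where r: "eval_recf r [x] = Some (if P x then 0 else 1)" for x
    using assms unfolding decidable_def by (rule computableE) blast
  define g where "g = Comp r [Comp pair_recf [Proj 0, Comp pair_recf [Proj 1, Proj 2]]]"
  have g: "eval_recf g [n, u, v] = Some (if P (pair n (pair u v)) then 0 else 1)" for n u v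
    unfolding g_def by (simp add: r)
  show ?thesis
  proof (rule that)
    fix u v assume ex: "\<exists>n. P (pair n (pair u v))"
    let ?n = "LEAST n. P (pair n (pair u v))"
    have "eval_recf (Mu g) [u, v] = Some ?n" using ex by (simp add: g)
    then have "eval_recf (Comp fst_recf [Mu g]) [u, v] = Some (pfst ?n)"
      by (simp del: eval_recf.simps(6))
    then show "\<exists>n. P (pair n (pair u v)) \<and> eval_recf (Comp fst_recf [Mu g]) [u, v] = Some (pfst n)"
      using LeastI_ex[OF ex] by blast
  qed
qed


section \<open>Computing with encoded lists\<close>

definition lcons :: "nat \<Rightarrow> nat \<Rightarrow> nat" where "lcons a l = Suc (pair a l)"
definition lhd :: "nat \<Rightarrow> nat" where "lhd l = pfst (l - 1)"
definition ltl :: "nat \<Rightarrow> nat" where "ltl l = psnd (l - 1)"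
definition ldrop :: "nat \<Rightarrow> nat \<Rightarrow> nat" where "ldrop i l = rec_nat l (\<lambda>_ r. ltl r) i"

text \<open>\<open>k\<close> rounds are enough, since a list is no longer than its code; rounds past
  the end change nothing.\<close>

definition lrev_app :: "nat \<Rightarrow> nat \<Rightarrow> nat" where
  "lrev_app k l = psnd (rec_nat (pair k l) (\<lambda>_ s.
     if pfst s = 0 then s else pair (ltl (pfst s)) (lcons (lhd (pfst s)) (psnd s))) k)"

definition lapp :: "nat \<Rightarrow> nat \<Rightarrow> nat" where
  "lapp k l = lrev_app (lrev_app k 0) l"

lemma computable_lcons [computable]: "computable f \<Longrightarrow> computable g \<Longrightarrow> computable (\<lambda>x. lcons (f x) (g x))"
  unfolding lcons_def by (intro computable)

lemma computable_lhd [computable]: "computable f \<Longrightarrow> computable (\<lambda>x. lhd (f x))"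
  unfolding lhd_def by (intro computable)

lemma computable_ltl [computable]: "computable f \<Longrightarrow> computable (\<lambda>x. ltl (f x))"
  unfolding ltl_def by (intro computable)

lemma computable_ldrop [computable]: "computable f \<Longrightarrow> computable g \<Longrightarrow> computable (\<lambda>x. ldrop (f x) (g x))"
  by (rule computable_curry[of ldrop]) (unfold ldrop_def, intro computable computable_rec)

lemma computable_lrev_app [computable]:
  "computable f \<Longrightarrow> computable g \<Longrightarrow> computable (\<lambda>x. lrev_app (f x) (g x))"
  by (rule computable_curry[of lrev_app]) (unfold lrev_app_def, intro computable computable_rec)

lemma computable_lapp [computable]: "computable f \<Longrightarrow> computable g \<Longrightarrow> computable (\<lambda>x. lapp (f x) (g x))"
  unfolding lapp_def by (intro computable)

lemma list_encode_Cons: "list_encode (x # xs) = lcons x (list_encode xs)"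
  by (simp add: lcons_def pair_def)

lemma lcons_simps [simp]: "lhd (lcons a l) = a" "ltl (lcons a l) = l" "lcons a l \<noteq> 0"
  by (simp_all add: lcons_def lhd_def ltl_def)

text \<open>Keeps \<open>ldrop\<close> at the empty list beyond the end.\<close>

lemma ltl_0: "ltl 0 = 0"
proof -
  have "pair 0 0 = 0" by (simp add: pair_def prod_encode_def)
  then show ?thesis by (metis diff_0_eq_0 ltl_def pair_simps(2))
qed

lemma ltl_encode: "ltl (list_encode xs) = list_encode (tl xs)"
  by (cases xs) (simp_all add: ltl_0 list_encode_Cons del: list_encode.simps(2))

lemma ldrop_encode: "ldrop i (list_encode xs) = list_encode (drop i xs)"
  unfolding ldrop_def by (induction i) (simp_all add: ltl_encode tl_drop drop_Suc)

lemma list_encode_eq_0 [simp]: "list_encode xs = 0 \<longleftrightarrow> xs = []"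
  by (cases xs) simp_all

lemma length_le_list_encode: "length xs \<le> list_encode xs"
proof (induction xs)
  case (Cons x xs)
  then show ?case using le_prod_encode_2[of "list_encode xs" x] by simp
qed simp

lemma lrev_app_encode: "lrev_app (list_encode xs) (list_encode ys) = list_encode (rev xs @ ys)"
proof -
  have "rec_nat (pair (list_encode xs) (list_encode ys)) (\<lambda>_ s.
      if pfst s = 0 then s else pair (ltl (pfst s)) (lcons (lhd (pfst s)) (psnd s))) n =
    pair (list_encode (drop n xs)) (list_encode (rev (take n xs) @ ys))" for n
  proof (induction n)
    case (Suc n)
    show ?case
    proof (cases "n < length xs")
      case True
      then have "drop n xs = xs ! n # drop (Suc n) xs" "take (Suc n) xs = take n xs @ [xs ! n]"
        by (simp_all add: Cons_nth_drop_Suc take_Suc_conv_app_nth)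
      then show ?thesis by (simp add: Suc list_encode_Cons del: list_encode.simps(2))
    qed (simp add: Suc)
  qed simp
  then show ?thesis unfolding lrev_app_def using length_le_list_encode[of xs] by simp
qed

lemma lapp_encode: "lapp (list_encode xs) (list_encode ys) = list_encode (xs @ ys)"
  using lrev_app_encode[of xs "[]"] by (simp add: lapp_def lrev_app_encode)


section \<open>Derivability is semidecidable\<close>

text \<open>
  A clause \<open>(H, Bs)\<close> has for every parameter \<open>e\<close> the conclusion \<open>H e\<close> and the premises \<open>B e\<close>,
  \<open>B \<in> Bs\<close>.  A proof is a list of pairs of a fact and the parameter that justifies it, each fact
  following from facts further down the list.
\<close>

type_synonym clause = "(nat \<Rightarrow> nat) \<times> (nat \<Rightarrow> nat) list"

inductive derivable :: "clause list \<Rightarrow> nat \<Rightarrow> bool" for cs where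
  "(H, Bs) \<in> set cs \<Longrightarrow> (\<And>B. B \<in> set Bs \<Longrightarrow> derivable cs (B e)) \<Longrightarrow> derivable cs (H e)"

lemma derivable_clause:
  "(H, Bs) \<in> set cs \<Longrightarrow> \<forall>B\<in>set Bs. derivable cs (B e) \<Longrightarrow> derivable cs (H e)"
  by (rule derivable.intros) auto

text \<open>The bound \<open>l\<close> exceeds no position too early, as a list is no longer than
  its code, and it keeps the search decidable.\<close>

definition proves :: "nat \<Rightarrow> nat \<Rightarrow> bool" where
  "proves l c \<longleftrightarrow> (\<exists>i<l. ldrop i l \<noteq> 0 \<and> pfst (lhd (ldrop i l)) = c)"

definition justified :: "clause list \<Rightarrow> nat \<Rightarrow> nat \<Rightarrow> bool" where
  "justified cs z l \<longleftrightarrow>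
     (\<exists>c\<in>set cs. pfst z = fst c (psnd z) \<and> (\<forall>B\<in>set (snd c). proves l (B (psnd z))))"

definition valid_proof :: "clause list \<Rightarrow> nat \<Rightarrow> bool" where
  "valid_proof cs l \<longleftrightarrow> (\<forall>i<l. ldrop i l \<noteq> 0 \<longrightarrow> justified cs (lhd (ldrop i l)) (ltl (ldrop i l)))"

lemma decidable_proves [computable]:
  "computable f \<Longrightarrow> computable g \<Longrightarrow> decidable (\<lambda>x. proves (f x) (g x))"
  by (rule decidable_curry[of proves]) (unfold proves_def, intro computable decidable_ex_less)

lemma decidable_valid_proof:
  assumes cs: "\<And>H Bs. (H, Bs) \<in> set cs \<Longrightarrow> computable H" "\<And>H Bs B. (H, Bs) \<in> set cs \<Longrightarrow> B \<in> set Bs \<Longrightarrow> computable B"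
    and f: "computable f"
  shows "decidable (\<lambda>x. valid_proof cs (f x))"
proof -
  have j: "decidable (\<lambda>x. justified cs (f x) (g x))" if fg: "computable f" "computable g" for f g
    unfolding justified_def
  proof (rule decidable_bex_list)
    fix c assume "c \<in> set cs"
    then have c: "(fst c, snd c) \<in> set cs" by simp
    have p: "computable (\<lambda>x. psnd (f x))" by (intro computable fg)
    show "decidable (\<lambda>x. pfst (f x) = fst c (psnd (f x)) \<and> (\<forall>B\<in>set (snd c). proves (g x) (B (psnd (f x)))))"
    proof (intro decidable_conj decidable_ball_list decidable_eq decidable_proves fg)
      show "computable (\<lambda>x. pfst (f x))" by (intro computable fg)
      show "computable (\<lambda>x. fst c (psnd (f x)))" by (rule computable_comp[OF cs(1)[OF c] p])
      show "computable (\<lambda>x. B (psnd (f x)))" if "B \<in> set (snd c)" for B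
        by (rule computable_comp[OF cs(2)[OF c that] p])
    qed
  qed
  have "decidable (\<lambda>l. \<forall>i<l. ldrop i l \<noteq> 0 \<longrightarrow> justified cs (lhd (ldrop i l)) (ltl (ldrop i l)))"
    by (intro decidable_all_less decidable_imp j computable)
  then have "decidable (valid_proof cs)" unfolding valid_proof_def[abs_def] .
  then show ?thesis using f by (rule decidable_comp)
qed

lemma proves_encode: "proves (list_encode zs) c \<longleftrightarrow> c \<in> pfst ` set zs"
proof -
  have "proves (list_encode zs) c \<longleftrightarrow> (\<exists>i<length zs. pfst (zs ! i) = c)"
  proof
    assume "proves (list_encode zs) c"
    then obtain i where "drop i zs \<noteq> []" "pfst (lhd (list_encode (drop i zs))) = c"
      by (auto simp: proves_def ldrop_encode)
    then show "\<exists>i<length zs. pfst (zs ! i) = c"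
      by (intro exI[of _ i]) (auto simp: list_encode_Cons Cons_nth_drop_Suc[symmetric] simp del: list_encode.simps(2))
  next
    assume "\<exists>i<length zs. pfst (zs ! i) = c"
    then obtain i where "i < length zs" "pfst (zs ! i) = c" by blast
    then show "proves (list_encode zs) c"
      using length_le_list_encode[of zs] unfolding proves_def ldrop_encode
      by (intro exI[of _ i]) (auto simp: list_encode_Cons Cons_nth_drop_Suc[symmetric] simp del: list_encode.simps(2))
  qed
  then show ?thesis by (metis image_iff in_set_conv_nth)
qed

lemma valid_proof_encode:
  "valid_proof cs (list_encode zs) \<longleftrightarrow>
     (\<forall>i<length zs. justified cs (zs ! i) (list_encode (drop (Suc i) zs)))"
proof -
  have "ldrop i (list_encode zs) \<noteq> 0 \<longleftrightarrow> i < length zs" for i by (auto simp: ldrop_encode)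
  moreover have "i < length zs \<Longrightarrow> i < list_encode zs" for i
    using length_le_list_encode[of zs] by simp
  moreover have "lhd (ldrop i (list_encode zs)) = zs ! i" "ltl (ldrop i (list_encode zs)) = list_encode (drop (Suc i) zs)"
    if "i < length zs" for i
    unfolding ldrop_encode using that
    by (simp_all add: list_encode_Cons Cons_nth_drop_Suc[symmetric] del: list_encode.simps(2))
  ultimately show ?thesis unfolding valid_proof_def by metis
qed

lemma valid_proof_Cons:
  "valid_proof cs (list_encode (z # zs)) \<longleftrightarrow>
     justified cs z (list_encode zs) \<and> valid_proof cs (list_encode zs)"
  unfolding valid_proof_encode by (auto simp: less_Suc_eq_0_disj)

text \<open>Entries of the first list keep the facts below them and only gain further ones.\<close>

lemma valid_proof_append:
  "valid_proof cs (list_encode xs) \<Longrightarrow> valid_proof cs (list_encode ys) \<Longrightarrow>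
   valid_proof cs (list_encode (xs @ ys))"
proof (induction xs)
  case (Cons z xs)
  have "justified cs z (list_encode (xs @ ys))"
    using Cons.prems unfolding valid_proof_Cons justified_def proves_encode by fastforce
  then show ?case using Cons unfolding append_Cons valid_proof_Cons by blast
qed simp

lemma valid_proof_sound:
  "valid_proof cs (list_encode zs) \<Longrightarrow> z \<in> set zs \<Longrightarrow> derivable cs (pfst z)"
proof (induction zs arbitrary: z)
  case (Cons y zs)
  then have IH: "derivable cs (pfst z)" if "z \<in> set zs" for z
    using that unfolding valid_proof_Cons by blast
  obtain H Bs where "(H, Bs) \<in> set cs" "pfst y = H (psnd y)" "\<forall>B\<in>set Bs. B (psnd y) \<in> pfst ` set zs"
    using Cons.prems(1) unfolding valid_proof_Cons justified_def proves_encode by force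
  then have "derivable cs (pfst y)" using derivable.intros[of H Bs cs "psnd y"] IH by force
  then show ?case using Cons.prems IH by auto
qed simp

lemma valid_proof_complete:
  "derivable cs c \<Longrightarrow> \<exists>zs. valid_proof cs (list_encode zs) \<and> c \<in> pfst ` set zs"
proof (induction rule: derivable.induct)
  case (1 H Bs e)
  have "\<exists>zs. valid_proof cs (list_encode zs) \<and> (\<forall>B\<in>set Bs'. B e \<in> pfst ` set zs)"
    if "set Bs' \<subseteq> set Bs" for Bs'
    using that
  proof (induction Bs')
    case Nil
    have "valid_proof cs (list_encode [])" by (simp add: valid_proof_def)
    then show ?case by (intro exI[of _ "[]"]) simp
  next
    case (Cons B Bs')
    then obtain xs where xs: "valid_proof cs (list_encode xs)" "\<forall>B\<in>set Bs'. B e \<in> pfst ` set xs" by auto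
    obtain ys where ys: "valid_proof cs (list_encode ys)" "B e \<in> pfst ` set ys"
      using 1(3)[of B] Cons.prems by (metis list.set_intros(1) subsetD)
    have "valid_proof cs (list_encode (xs @ ys))" using xs ys by (intro valid_proof_append)
    moreover have "\<forall>B\<in>set (B # Bs'). B e \<in> pfst ` set (xs @ ys)" using xs ys by auto
    ultimately show ?case by blast
  qed
  then obtain zs where zs: "valid_proof cs (list_encode zs)" "\<forall>B\<in>set Bs. B e \<in> pfst ` set zs" by blast
  have "justified cs (pair (H e) e) (list_encode zs)"
    unfolding justified_def proves_encode using 1(1) zs(2) by force
  then have "valid_proof cs (list_encode (pair (H e) e # zs))" using zs(1) by (simp only: valid_proof_Cons)
  moreover have "H e \<in> pfst ` set (pair (H e) e # zs)" by simp
  ultimately show ?case by blast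
qed

lemma derivable_iff: "derivable cs c \<longleftrightarrow> (\<exists>l. valid_proof cs l \<and> proves l c)"
proof
  assume "\<exists>l. valid_proof cs l \<and> proves l c"
  then obtain zs where "valid_proof cs (list_encode zs)" "proves (list_encode zs) c"
    by (metis list_decode_inverse)
  then show "derivable cs c" using valid_proof_sound by (auto simp: proves_encode)
qed (metis proves_encode valid_proof_complete)


section \<open>Equality of swords as derivability\<close>

text \<open>The code of a one-element word: \<open>sum_encode (Inr n)\<close> is
  \<open>2 * n + 1\<close>, with the double written as a sum so that \<open>computable_add\<close>
  applies.\<close>

definition pw :: "nat \<Rightarrow> nat \<Rightarrow> nat" where
  "pw x q = lcons (Suc (pair x q + pair x q)) 0"

text \<open>The predecessor of an integer under \<open>int_encode\<close>, which maps \<open>0, -1, 1, -2, 2, \<dots>\<close> to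
  \<open>0, 1, 2, 3, 4, \<dots>\<close>.\<close>

definition ipred :: "nat \<Rightarrow> nat" where
  "ipred q = (if q = 0 then 1 else if even q then q - 2 else q + 2)"

lemma ipred_encode: "ipred (int_encode q) = int_encode (q - 1)"
  unfolding ipred_def int_encode_def sum_encode_def by (auto simp: nat_diff_distrib)

lemma computable_pw [computable]: "computable f \<Longrightarrow> computable g \<Longrightarrow> computable (\<lambda>x. pw (f x) (g x))"
  unfolding pw_def by (intro computable)

lemma computable_ipred [computable]: "computable f \<Longrightarrow> computable (\<lambda>x. ipred (f x))"
  by (rule computable_comp) (unfold ipred_def, intro computable)

text \<open>The clauses follow the introduction rules of \<open>sword_eq\<close>; bases of powers are non-empty, so
  their codes are successors.\<close>

definition sword_clauses :: "clause list" where
  "sword_clauses =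
    [(\<lambda>e. pair e e, []),
     (\<lambda>e. pair (psnd e) (pfst e), [\<lambda>e. e]),
     (\<lambda>e. pair (pfst e) (psnd (psnd e)), [\<lambda>e. pair (pfst e) (pfst (psnd e)), \<lambda>e. psnd e]),
     (\<lambda>e. pair (lapp (pfst (pfst e)) (pfst (psnd e))) (lapp (psnd (pfst e)) (psnd (psnd e))),
       [\<lambda>e. pfst e, \<lambda>e. psnd e]),
     (\<lambda>e. pair (pw (Suc (pfst (pfst e))) (psnd e)) (pw (Suc (psnd (pfst e))) (psnd e)),
       [\<lambda>e. pair (Suc (pfst (pfst e))) (Suc (psnd (pfst e)))]),
     (\<lambda>e. pair (pw (Suc (pfst e)) (psnd e))
       (lapp (Suc (pfst e)) (pw (Suc (pfst e)) (ipred (psnd e)))), []),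
     (\<lambda>e. pair (pw (Suc (pfst e)) (psnd e))
       (lapp (pw (Suc (pfst e)) (ipred (psnd e))) (Suc (pfst e))), []),
     (\<lambda>e. pair (lapp (Suc (pfst (pfst e)))
         (pw (lapp (Suc (psnd (pfst e))) (Suc (pfst (pfst e)))) (psnd e)))
       (lapp (pw (lapp (Suc (pfst (pfst e))) (Suc (psnd (pfst e)))) (psnd e))
         (Suc (pfst (pfst e)))), [])]"

lemmas set_sword_clauses = arg_cong[OF sword_clauses_def, of set, unfolded list.set]

lemma computable_sword_clauses:
  "(H, Bs) \<in> set sword_clauses \<Longrightarrow> computable H"
  "(H, Bs) \<in> set sword_clauses \<Longrightarrow> B \<in> set Bs \<Longrightarrow> computable B"
  unfolding sword_clauses_def
  by (auto intro!: computable)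

text \<open>Letters have even codes and formal powers have odd ones.\<close>

definition code_branches :: "nat \<Rightarrow> nat \<Rightarrow> bool" where
  "code_branches k l \<longleftrightarrow> k = 0 \<or> l = 0 \<or> even (lhd k) \<and> even (lhd l) \<and> lhd k \<noteq> lhd l"

text \<open>A certificate consists of codes of the common prefix, of the two remainders, and of proofs
  that the inputs are the products.\<close>

definition certifies :: "nat \<Rightarrow> nat \<Rightarrow> nat \<Rightarrow> nat \<Rightarrow> nat \<Rightarrow> nat \<Rightarrow> nat \<Rightarrow> bool" where
  "certifies u v w a b l m \<longleftrightarrow>
     valid_proof sword_clauses l \<and> proves l (pair u (lapp w a)) \<and>
     valid_proof sword_clauses m \<and> proves m (pair v (lapp w b)) \<and> code_branches a b"

text \<open>The code of the prefix is the first component of the witness, which is the one that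
  \<open>search\<close> returns.\<close>

definition certificate :: "nat \<Rightarrow> bool" where
  "certificate x \<longleftrightarrow>
     certifies (pfst (psnd x)) (psnd (psnd x)) (pfst (pfst x)) (pfst (pfst (psnd (pfst x))))
       (psnd (pfst (psnd (pfst x)))) (pfst (psnd (psnd (pfst x)))) (psnd (psnd (psnd (pfst x))))"

lemma decidable_certificate: "decidable certificate"
  unfolding certificate_def[abs_def] certifies_def code_branches_def
  by (intro computable decidable_valid_proof[OF computable_sword_clauses])

lemma certificate_pair:
  "certificate (pair (pair w (pair (pair a b) (pair l m))) (pair u v)) \<longleftrightarrow> certifies u v w a b l m"
  by (simp add: certificate_def)

lemma certificate_cases:
  assumes "certificate (pair n (pair u v))"
  obtains a b l m where "certifies u v (pfst n) a b l m"
  using assms unfolding certificate_def by simp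

section \<open>Words and their codes\<close>

context
  fixes code :: "'a \<Rightarrow> nat"
  assumes inj: "inj code"
begin

abbreviation enc :: "'a zword \<Rightarrow> nat" where
  "enc \<equiv> encode_word code"

lemma encode_factor_inj: "encode_factor code f = encode_factor code g \<Longrightarrow> f = g"
proof (induction f arbitrary: g)
  case (Letter a)
  then show ?case using inj by (cases g) (auto simp: sum_encode_eq dest: injD)
next
  case (Power a as q)
  then obtain b bs r where g: "g = Power b bs r"
    by (cases g) (auto simp: sum_encode_eq)
  with Power.prems have *: "encode_factor code a = encode_factor code b"
    "map (encode_factor code) as = map (encode_factor code) bs" "q = r"
    by (auto simp: sum_encode_eq prod_encode_eq list_encode_eq int_encode_eq)
  have "as = bs" using *(2) by (rule list.inj_map_strong[rotated]) (rule Power.IH(2))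
  then show ?case using * g Power.IH(1) by simp
qed

lemma enc_inj: "enc u = enc v \<longleftrightarrow> u = v"
proof
  assume "enc u = enc v"
  then have "map (encode_factor code) u = map (encode_factor code) v"
    by (simp add: encode_word_def list_encode_eq)
  then show "u = v"
    by (rule list.inj_map_strong[rotated]) (rule encode_factor_inj)
qed simp

lemma enc_Nil [simp]: "enc [] = 0"
  by (simp add: encode_word_def)

lemma enc_eq_0 [simp]: "enc w = 0 \<longleftrightarrow> w = []"
  by (simp add: encode_word_def)

lemma enc_append: "enc (x @ y) = lapp (enc x) (enc y)"
  by (simp add: encode_word_def lapp_encode)

lemma encode_Power: "encode_factor code (Power a as q) = Suc (2 * pair (enc (a # as)) (int_encode q))"
  by (simp add: encode_word_def sum_encode_def pair_def)

lemma enc_zpow: "x \<noteq> [] \<Longrightarrow> enc (zpow x q) = pw (enc x) (int_encode q)"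
proof (cases x)
  case (Cons a as)
  have "enc [Power a as q] = lcons (encode_factor code (Power a as q)) 0"
    unfolding encode_word_def list.map list_encode_Cons list_encode.simps(1) ..
  then show ?thesis unfolding Cons zpow.simps encode_Power pw_def mult_2 .
qed simp

text \<open>Here \<open>k\<close> and \<open>l\<close> are arbitrary numbers: each decodes to some
  list, and the appended list codes a word only if both parts do.\<close>

lemma enc_eq_lapp: "enc w = lapp k l \<longleftrightarrow> (\<exists>x y. w = x @ y \<and> enc x = k \<and> enc y = l)"
proof
  assume "enc w = lapp k l"
  then have "list_encode (map (encode_factor code) w) = list_encode (list_decode k @ list_decode l)"
    using lapp_encode[of "list_decode k" "list_decode l"] by (simp add: encode_word_def)
  then have "map (encode_factor code) w = list_decode k @ list_decode l" by (simp only: list_encode_eq)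
  then obtain x y where "w = x @ y"
    "map (encode_factor code) x = list_decode k" "map (encode_factor code) y = list_decode l"
    by (metis append_eq_map_conv)
  then show "\<exists>x y. w = x @ y \<and> enc x = k \<and> enc y = l"
    by (metis encode_word_def list_decode_inverse)
qed (auto simp: enc_append)

lemma enc_eq_pw:
  "enc w = pw k (int_encode q) \<longleftrightarrow> (\<exists>x. x \<noteq> [] \<and> w = zpow x q \<and> enc x = k)"
proof
  assume "enc w = pw k (int_encode q)"
  then have "list_encode (map (encode_factor code) w) = list_encode [Suc (2 * pair k (int_encode q))]"
    unfolding encode_word_def pw_def list_encode_Cons list_encode.simps(1) mult_2 .
  then have "map (encode_factor code) w = [Suc (2 * pair k (int_encode q))]" by (simp only: list_encode_eq)
  then obtain f where f: "w = [f]" "encode_factor code f = Suc (2 * pair k (int_encode q))" by auto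
  show "\<exists>x. x \<noteq> [] \<and> w = zpow x q \<and> enc x = k"
  proof (cases f)
    case (Letter a)
    then have "2 * code a = Suc (2 * pair k (int_encode q))" using f(2) by (simp add: sum_encode_def)
    then show ?thesis by presburger
  next
    case (Power a as r)
    then have "pair (enc (a # as)) (int_encode r) = pair k (int_encode q)"
      using f(2) by (simp add: encode_Power del: encode_factor.simps)
    then have "enc (a # as) = k" "int_encode r = int_encode q"
      by (metis pair_simps(1)) (metis pair_simps(2) \<open>pair _ _ = pair _ _\<close>)
    then show ?thesis using f(1) Power by (intro exI[of _ "a # as"]) (simp add: int_encode_eq)
  qed
qed (auto simp: enc_zpow)

text \<open>Two-sided, so that a code is never related to a number that is not one. A derivation by
  transitivity therefore cannot pass from one word to another through a number without
  meaning.\<close>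

definition code_eq :: "nat \<Rightarrow> nat \<Rightarrow> bool" where
  "code_eq k l \<longleftrightarrow> (\<forall>u. enc u = k \<longrightarrow> (\<exists>v. enc v = l \<and> sword_eq u v)) \<and>
     (\<forall>v. enc v = l \<longrightarrow> (\<exists>u. enc u = k \<and> sword_eq u v))"

lemma code_eqI:
  assumes "\<And>u. enc u = k \<Longrightarrow> \<exists>v. enc v = l \<and> sword_eq u v"
    and "\<And>v. enc v = l \<Longrightarrow> \<exists>u. enc u = k \<and> sword_eq u v"
  shows "code_eq k l"
  using assms unfolding code_eq_def by blast

lemma code_eq_sym: "code_eq k l \<Longrightarrow> code_eq l k"
  unfolding code_eq_def using sword_eq.sym by blast

lemma code_eq_trans: "code_eq k l \<Longrightarrow> code_eq l m \<Longrightarrow> code_eq k m"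
proof (rule code_eqI)
  assume *: "code_eq k l" "code_eq l m"
  show "\<exists>w. enc w = m \<and> sword_eq u w" if u: "enc u = k" for u
  proof -
    obtain v where "enc v = l" "sword_eq u v" using * u unfolding code_eq_def by metis
    moreover from this obtain w where "enc w = m" "sword_eq v w" using * unfolding code_eq_def by metis
    ultimately show ?thesis using sword_eq.trans by blast
  qed
  show "\<exists>u. enc u = k \<and> sword_eq u w" if w: "enc w = m" for w
  proof -
    obtain v where "enc v = l" "sword_eq v w" using * w unfolding code_eq_def by metis
    moreover from this obtain u where "enc u = k" "sword_eq u v" using * unfolding code_eq_def by metis
    ultimately show ?thesis using sword_eq.trans by blast
  qed
qed

lemma code_eq_conc: "code_eq k k' \<Longrightarrow> code_eq l l' \<Longrightarrow> code_eq (lapp k l) (lapp k' l')"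
proof (rule code_eqI)
  assume *: "code_eq k k'" "code_eq l l'"
  {
    fix u assume "enc u = lapp k l"
    then obtain x y where "u = x @ y" "enc x = k" "enc y = l" by (auto simp: enc_eq_lapp)
    moreover from this obtain x' y' where "enc x' = k'" "enc y' = l'" "sword_eq x x'" "sword_eq y y'"
      using * unfolding code_eq_def by metis
    ultimately show "\<exists>v. enc v = lapp k' l' \<and> sword_eq u v"
      by (intro exI[of _ "x' @ y'"]) (auto simp: enc_append intro: sword_eq.conc)
  next
    fix v assume "enc v = lapp k' l'"
    then obtain x' y' where "v = x' @ y'" "enc x' = k'" "enc y' = l'" by (auto simp: enc_eq_lapp)
    moreover from this obtain x y where "enc x = k" "enc y = l" "sword_eq x x'" "sword_eq y y'"
      using * unfolding code_eq_def by metis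
    ultimately show "\<exists>u. enc u = lapp k l \<and> sword_eq u v"
      by (intro exI[of _ "x @ y"]) (auto simp: enc_append intro: sword_eq.conc)
  }
qed

lemma int_encode_cases: obtains q' where "q = int_encode q'"
  by (metis int_decode_inverse)

lemma code_eq_pow: "code_eq k l \<Longrightarrow> code_eq (pw k q) (pw l q)"
  by (cases q rule: int_encode_cases)
    (auto simp: code_eq_def enc_eq_pw; metis sword_eq.pow sword_eq_Nil)

lemma code_eq_unfold_left: "code_eq (pw (Suc k) q) (lapp (Suc k) (pw (Suc k) (ipred q)))"
  by (cases q rule: int_encode_cases)
    (auto simp: ipred_encode enc_eq_pw enc_eq_lapp intro!: code_eqI; metis enc_inj sword_eq.unfold_left)

lemma code_eq_unfold_right: "code_eq (pw (Suc k) q) (lapp (pw (Suc k) (ipred q)) (Suc k))"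
  by (cases q rule: int_encode_cases)
    (auto simp: ipred_encode enc_eq_pw enc_eq_lapp intro!: code_eqI; metis enc_inj sword_eq.unfold_right)

lemma code_eq_shift:
  "code_eq (lapp (Suc k) (pw (lapp (Suc l) (Suc k)) q)) (lapp (pw (lapp (Suc k) (Suc l)) q) (Suc k))"
proof (cases q rule: int_encode_cases)
  case (1 q')
  have *: "sword_eq (x @ zpow (y @ x) q') (zpow (x @ y) q' @ x)" if "enc x = Suc k" "enc y = Suc l" for x y
    using that by (intro sword_eq.shift) auto
  show ?thesis
    unfolding 1 by (rule code_eqI) (auto simp: enc_eq_pw enc_eq_lapp enc_inj; metis * enc_inj append_is_Nil_conv)+
qed

lemma derivable_sound: "derivable sword_clauses c \<Longrightarrow> code_eq (pfst c) (psnd c)"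
proof (induction rule: derivable.induct)
  case (1 H Bs e)
  have IH: "\<forall>B\<in>set Bs. code_eq (pfst (B e)) (psnd (B e))" using 1(3) by blast
  have "code_eq k k" for k by (auto intro: code_eqI sword_eq.refl)
  note rules = this code_eq_pow code_eq_unfold_left code_eq_unfold_right code_eq_shift
  from 1(1) show ?case
    unfolding set_sword_clauses
  proof (elim insertE emptyE)
    assume "(H, Bs) = (\<lambda>e. pair (psnd e) (pfst e), [\<lambda>e. e])"
    then show ?thesis using IH by (simp add: code_eq_sym)
  next
    assume "(H, Bs) = (\<lambda>e. pair (pfst e) (psnd (psnd e)), [\<lambda>e. pair (pfst e) (pfst (psnd e)), \<lambda>e. psnd e])"
    then show ?thesis using IH code_eq_trans[of "pfst e" "pfst (psnd e)"] by simp
  next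
    assume "(H, Bs) = (\<lambda>e. pair (lapp (pfst (pfst e)) (pfst (psnd e))) (lapp (psnd (pfst e)) (psnd (psnd e))),
       [\<lambda>e. pfst e, \<lambda>e. psnd e])"
    then show ?thesis using IH by (simp add: code_eq_conc)
  qed (use IH rules in simp_all)
qed

lemma derivable_complete: "sword_eq u v \<Longrightarrow> derivable sword_clauses (pair (enc u) (enc v))"
proof (induction rule: sword_eq.induct)
  case (refl x)
  show ?case
    using derivable_clause[of "\<lambda>e. pair e e" "[]" sword_clauses "enc x"]
    by (simp add: set_sword_clauses)
next
  case (sym x y)
  then show ?case
    using derivable_clause[of "\<lambda>e. pair (psnd e) (pfst e)" "[\<lambda>e. e]" sword_clauses "pair (enc x) (enc y)"]
    by (simp add: set_sword_clauses)
next
  case (trans x y z)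
  then show ?case
    using derivable_clause[of "\<lambda>e. pair (pfst e) (psnd (psnd e))"
        "[\<lambda>e. pair (pfst e) (pfst (psnd e)), \<lambda>e. psnd e]" sword_clauses "pair (enc x) (pair (enc y) (enc z))"]
    by (auto simp: set_sword_clauses)
next
  case (conc x x' y y')
  then show ?case
    using derivable_clause[of
        "\<lambda>e. pair (lapp (pfst (pfst e)) (pfst (psnd e))) (lapp (psnd (pfst e)) (psnd (psnd e)))"
        "[\<lambda>e. pfst e, \<lambda>e. psnd e]" sword_clauses "pair (pair (enc x) (enc x')) (pair (enc y) (enc y'))"]
    by (auto simp: set_sword_clauses enc_append)
next
  case (pow x y q)
  then obtain k l where "enc x = Suc k" "enc y = Suc l" by (metis enc_eq_0 not0_implies_Suc)
  then show ?case
    using pow derivable_clause[of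
        "\<lambda>e. pair (pw (Suc (pfst (pfst e))) (psnd e)) (pw (Suc (psnd (pfst e))) (psnd e))"
        "[\<lambda>e. pair (Suc (pfst (pfst e))) (Suc (psnd (pfst e)))]" sword_clauses
        "pair (pair k l) (int_encode q)"]
    by (simp add: set_sword_clauses enc_zpow)
next
  case (unfold_left x q)
  then obtain k where "enc x = Suc k" by (metis enc_eq_0 not0_implies_Suc)
  then show ?case
    using unfold_left derivable_clause[of
        "\<lambda>e. pair (pw (Suc (pfst e)) (psnd e)) (lapp (Suc (pfst e)) (pw (Suc (pfst e)) (ipred (psnd e))))"
        "[]" sword_clauses "pair k (int_encode q)"]
    by (simp add: set_sword_clauses enc_zpow enc_append ipred_encode)
next
  case (unfold_right x q)
  then obtain k where "enc x = Suc k" by (metis enc_eq_0 not0_implies_Suc)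
  then show ?case
    using unfold_right derivable_clause[of
        "\<lambda>e. pair (pw (Suc (pfst e)) (psnd e)) (lapp (pw (Suc (pfst e)) (ipred (psnd e))) (Suc (pfst e)))"
        "[]" sword_clauses "pair k (int_encode q)"]
    by (simp add: set_sword_clauses enc_zpow enc_append ipred_encode)
next
  case (shift x y q)
  then obtain k l where "enc x = Suc k" "enc y = Suc l" by (metis enc_eq_0 not0_implies_Suc)
  then show ?case
    using shift derivable_clause[of
        "\<lambda>e. pair (lapp (Suc (pfst (pfst e)))
             (pw (lapp (Suc (psnd (pfst e))) (Suc (pfst (pfst e)))) (psnd e)))
           (lapp (pw (lapp (Suc (pfst (pfst e))) (Suc (psnd (pfst e)))) (psnd e)) (Suc (pfst (pfst e))))"
        "[]" sword_clauses "pair (pair k l) (int_encode q)"]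
    by (simp add: set_sword_clauses enc_zpow enc_append)
qed

lemma derivable_iff_sword_eq: "derivable sword_clauses (pair (enc u) (enc v)) \<longleftrightarrow> sword_eq u v"
  using derivable_sound[of "pair (enc u) (enc v)"] derivable_complete
  by (auto simp: code_eq_def enc_inj)

lemma derivable_enc:
  assumes "derivable sword_clauses (pair (enc u) (lapp k l))"
  obtains x y where "enc x = k" "enc y = l" "sword_eq u (x @ y)"
  using derivable_sound[OF assms] unfolding code_eq_def by (auto simp: enc_eq_lapp)

lemma lhd_enc: "lhd (enc (f # w)) = encode_factor code f"
  unfolding encode_word_def list.map list_encode_Cons by simp

lemma even_encode_factor: "even (encode_factor code f) \<longleftrightarrow> (\<exists>a. f = Letter a)"
  by (cases f) (auto simp: sum_encode_def)

lemma code_branches_sound: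
  assumes "code_branches (enc u) (enc v)"
  shows "branches (sword_of u) (sword_of v)"
proof (cases "u = [] \<or> v = []")
  case True
  then show ?thesis by (auto simp: branches_def sword_of_simps)
next
  case False
  then obtain f u' g v' where uv: "u = f # u'" "v = g # v'" by (metis neq_Nil_conv)
  then obtain a b where "f = Letter a" "g = Letter b" "a \<noteq> b"
    using assms even_encode_factor unfolding code_branches_def by (auto simp: lhd_enc)
  then have "sword_of u = letter a * sword_of u'" "sword_of v = letter b * sword_of v'" "a \<noteq> b"
    using uv sword_of_Cons[of "Letter a" u'] sword_of_Cons[of "Letter b" v']
    by (simp_all add: sword_of_simps)
  then show ?thesis unfolding branches_def by blast
qed

text \<open>A given representative may begin with a formal power, which \<open>code_branches\<close>
  does not accept; representatives with the first letter in front are chosen instead.\<close>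

lemma code_branches_complete:
  assumes "branches x y"
  obtains u v where "x = sword_of u" "y = sword_of v" "code_branches (enc u) (enc v)"
proof -
  obtain u v where uv: "x = sword_of u" "y = sword_of v" by (metis sword_of_surj)
  show ?thesis
  proof (cases "x = 1 \<or> y = 1")
    case True
    then show ?thesis using that[of u v] uv by (auto simp: code_branches_def)
  next
    case False
    then obtain a b x' y' where ab: "a \<noteq> b" "x = letter a * x'" "y = letter b * y'"
      using assms by (auto simp: branches_def)
    obtain u' v' where uv': "x' = sword_of u'" "y' = sword_of v'" by (metis sword_of_surj)
    show ?thesis
    proof (rule that[of "Letter a # u'" "Letter b # v'"])
      show "x = sword_of (Letter a # u')" "y = sword_of (Letter b # v')"
        using ab uv' sword_of_Cons[of "Letter a" u'] sword_of_Cons[of "Letter b" v']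
        by (simp_all add: sword_of_simps)
      show "code_branches (enc (Letter a # u')) (enc (Letter b # v'))"
        unfolding code_branches_def lhd_enc using ab(1) inj by (simp add: sum_encode_def inj_eq)
    qed
  qed
qed

lemma certificate_exists:
  assumes "has_lcp (sword_of u) (sword_of v)"
  shows "\<exists>n. certificate (pair n (pair (enc u) (enc v)))"
proof -
  obtain t x y where t: "sword_of u = t * x" "sword_of v = t * y" "branches x y"
    using assms unfolding has_lcp_def by blast
  obtain w where w: "t = sword_of w" by (rule sword_of_surj)
  obtain a b where ab: "x = sword_of a" "y = sword_of b" "code_branches (enc a) (enc b)"
    using t(3) by (rule code_branches_complete)
  have "sword_eq u (w @ a)" "sword_eq v (w @ b)"
    using t w ab by (simp_all add: sword_of_simps flip: sword_of_eq_iff)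
  then have "derivable sword_clauses (pair (enc u) (lapp (enc w) (enc a)))"
    "derivable sword_clauses (pair (enc v) (lapp (enc w) (enc b)))"
    by (simp_all add: derivable_iff_sword_eq flip: enc_append)
  then obtain l m where "certifies (enc u) (enc v) (enc w) (enc a) (enc b) l m"
    using ab(3) unfolding derivable_iff certifies_def by blast
  then show ?thesis using certificate_pair by blast
qed

lemma certificate_sound:
  assumes "certificate (pair n (pair (enc u) (enc v)))"
  obtains w where "pfst n = enc w" "longest_common_prefix (sword_of u) (sword_of v) (sword_of w)"
proof -
  obtain a b l m where "certifies (enc u) (enc v) (pfst n) a b l m"
    using assms by (rule certificate_cases)
  then have d: "derivable sword_clauses (pair (enc u) (lapp (pfst n) a))"
    "derivable sword_clauses (pair (enc v) (lapp (pfst n) b))" and br: "code_branches a b"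
    unfolding certifies_def derivable_iff by blast+
  obtain w x where wx: "enc w = pfst n" "enc x = a" "sword_eq u (w @ x)" using d(1) by (rule derivable_enc)
  obtain w' y where wy: "enc w' = pfst n" "enc y = b" "sword_eq v (w' @ y)" using d(2) by (rule derivable_enc)
  \<comment> \<open>Both proofs mention the number \<open>pfst n\<close>, so injectivity of the
    encoding gives the same prefix word.\<close>
  have "w' = w" using wx wy enc_inj by metis
  then have "sword_of u = sword_of w * sword_of x" "sword_of v = sword_of w * sword_of y"
    using wx wy by (metis sword_of_eq_iff sword_of_simps(2))+
  moreover have "branches (sword_of x) (sword_of y)" using code_branches_sound br wx wy by blast
  ultimately show ?thesis using that branches_lcp wx(1) by metis
qed

end

theorem proposition2:
  fixes code :: "'a \<Rightarrow> nat" and h :: nat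
  assumes "inj code"
  shows "\<exists>f. \<forall>u v :: 'a zword.
           normal_sword (sword_of u) \<and> sword_height (sword_of u) \<le> Fin h \<and>
           normal_sword (sword_of v) \<and> sword_height (sword_of v) \<le> Fin h \<longrightarrow>
           (\<exists>w. eval_recf f [encode_word code u, encode_word code v] = Some (encode_word code w) \<and>
                longest_common_prefix (sword_of u) (sword_of v) (sword_of w))"
proof -
  \<comment> \<open>One program for all inputs; normality guarantees that its search ends.\<close>
  obtain f where f: "\<exists>n. certificate (pair n (pair u v)) \<Longrightarrow>
      \<exists>n. certificate (pair n (pair u v)) \<and> eval_recf f [u, v] = Some (pfst n)" for u v
    using decidable_certificate by (rule search) blast
  show ?thesis
  proof (intro exI[of _ f] allI impI, elim conjE)
    fix u v :: "'a zword"
    assume "normal_sword (sword_of u)" "normal_sword (sword_of v)"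
    then have "has_lcp (sword_of u) (sword_of v)" by (rule normal_has_lcp)
    then obtain n where n: "certificate (pair n (pair (encode_word code u) (encode_word code v)))"
      "eval_recf f [encode_word code u, encode_word code v] = Some (pfst n)"
      using f certificate_exists[OF assms] by blast
    show "\<exists>w. eval_recf f [encode_word code u, encode_word code v] = Some (encode_word code w) \<and>
        longest_common_prefix (sword_of u) (sword_of v) (sword_of w)"
      using certificate_sound[OF assms n(1)] n(2) by metis
  qed
qed

end
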